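(* Let $\mathbf{B}_1\in\mathbb{H}^{r\times s}_{r_1}$, $\mathbf{A}_2\in\mathbb{H}^{m\times p}_{r_2}$, $\mathbf{C}\in\mathbb{H}^{m\times s}$, and let $\mathbf{X}_1=\mathbf{C}\mathbf{B}_1^\dagger=(x^{(1)}_{ij})\in\mathbb{H}^{m\times r}$ and $\mathbf{X}_2=\mathbf{A}_2^\dagger\mathbf{C}-\mathbf{A}_2^\dagger\mathbf{C}\mathbf{P}_{B_1}=(x^{(2)}_{gf})\in\mathbb{H}^{p\times s}$. Let $\mathbf{c}^{(1)}_{i.}$ be the $i$th row of $\mathbf{C}_1=\mathbf{C}\mathbf{B}_1^*$, $\mathbf{c}^{(2)}_{.f}$ the $f$th column of $\mathbf{C}_2=\mathbf{A}_2^*\mathbf{C}$, and $\dot{\mathbf{b}}^{(1)}_{.f}$ the $f$th column of $\mathbf{B}_1^*\mathbf{B}_1$. Then $$x^{(1)}_{ij}=\frac{\sum_{\alpha\in I_{r_1,r}\{j\}}\mathrm{rdet}_j\big((\mathbf{B}_1\mathbf{B}_1^* )_{j.}(\mathbf{c}^{(1)}_{i.})\big)^\alpha_\alpha}{\sum_{\alpha\in I_{r_1,r}}|\mathbf{B}_1\mathbf{B}_1^*|^\alpha_\alpha},$$ $$x^{(2)}_{gf}=\frac{\sum_{\beta\in J_{r_2,p}\{g\}}\mathrm{cdet}_g\big((\mathbf{A}_2^*\mathbf{A}_2)_{.g}(\mathbf{c}^{(2)}_{.f})\big)^\beta_\beta}{\sum_{\beta\in J_{r_2,p}}|\mathbf{A}_2^*\mathbf{A}_2|^\beta_\beta}-\frac{\sum_{l=1}^s\sum_{\beta\in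 J_{r_2,p}\{g\}}\mathrm{cdet}_g\big((\mathbf{A}_2^*\mathbf{A}_2)_{.g}(\mathbf{c}^{(2)}_{.l})\big)^\beta_\beta\sum_{\beta\in J_{r_1,s}\{l\}}\mathrm{cdet}_l\big((\mathbf{B}_1^*\mathbf{B}_1)_{.l}(\dot{\mathbf{b}}^{(1)}_{.f})\big)^\beta_\beta}{\sum_{\beta\in J_{r_2,p}}|\mathbf{A}_2^*\mathbf{A}_2|^\beta_\beta\sum_{\beta\in J_{r_1,s}}|\mathbf{B}_1^*\mathbf{B}_1|^\beta_\beta}.$$
   Context: $\mathbb{H}$ is the skew field of real quaternions; $\mathbb{H}^{m\times n}$ is the set of $m\times n$ matrices over $\mathbb{H}$ and $\mathbb{H}^{m\times n}_r$ the subset of those of rank $r$. $\mathbf{A}^*$ is the conjugate transpose and $\mathbf{A}^\dagger$ the Moore–Penrose inverse (the unique $\mathbf{X}$ with $\mathbf{AXA}=\mathbf{A}$, $\mathbf{XAX}=\mathbf{X}$, $(\mathbf{AX})^*=\mathbf{AX}$, $(\mathbf{XA})^*=\mathbf{XA}$). $\mathbf{P}_A=\mathbf{A}^\dagger\mathbf{A}$. For a matrix $\mathbf{F}$, $\mathbf{F}_{.j}(\mathbf{b})$ (resp. $\mathbf{F}_{i.}(\mathbf{b})$) is $\mathbf{F}$ with its $j$th column (resp. $i$th row) replaced by the column (resp. row) $\mathbf{b}$. Row/column determinants: for $\mathbf{F}=(a_{ij})\in\mathbb{H}^{n\times n}$, $\mathrm{rdet}_i\mathbf{F}=\sum_{\sigma\in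 S_n}(-1)^{n-r}(a_{i\,i_{k_1}}a_{i_{k_1}i_{k_1+1}}\cdots a_{i_{k_1+l_1}i})\cdots(a_{i_{k_r}i_{k_r+1}}\cdots a_{i_{k_r+l_r}i_{k_r}})$, where $\sigma=(i\,i_{k_1}\,i_{k_1+1}\cdots i_{k_1+l_1})(i_{k_2}\cdots i_{k_2+l_2})\cdots(i_{k_r}\cdots i_{k_r+l_r})$ is the decomposition of $\sigma$ into $r$ disjoint cycles (fixed points included) with $i_{k_2}<\cdots<i_{k_r}$ and $i_{k_t}<i_{k_t+s}$ for $t=2,\dots,r$, $s=1,\dots,l_t$; and $\mathrm{cdet}_j\mathbf{F}=\sum_{\tau\in S_n}(-1)^{n-r}(a_{j_{k_r}j_{k_r+l_r}}\cdots a_{j_{k_r+1}j_{k_r}})\cdots(a_{j\,j_{k_1+l_1}}\cdots a_{j_{k_1+1}j_{k_1}}a_{j_{k_1}j})$, where $\tau=(j_{k_r+l_r}\cdots j_{k_r+1}\,j_{k_r})\cdots(j_{k_2+l_2}\cdots j_{k_2})(j_{k_1+l_1}\cdots j_{k_1+1}\,j_{k_1}\,j)$ is the decomposition into $r$ disjoint cycles with $j_{k_2}<\cdots<j_{k_r}$ and $j_{k_t}<j_{k_t+s}$ for $t=2,\dots,r$, $s=1,\dots,l_t$. For Hermitian $\mathbf{F}$ all these coincide and are real; this value is $\det\mathbf{F}$. Index sets: $L_{k,n}$ is the set of strictly increasing sequences $\alpha=(\alpha_1<\cdots<\alpha_k)$ in $\{1,\dots,n\}$; $I_{k,m}\{i\}=\{\alpha\in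 L_{k,m}: i\in\alpha\}$, $J_{k,n}\{j\}=\{\beta\in L_{k,n}: j\in\beta\}$; sums over $J_{k,n}$ or $I_{k,m}$ without braces run over all of $L_{k,n}$, $L_{k,m}$. For a square $\mathbf{F}$, $\mathbf{F}^\alpha_\alpha$ is the principal submatrix with rows and columns indexed by $\alpha$; $\mathrm{cdet}_i(\mathbf{G})^\beta_\beta$ (resp. $\mathrm{rdet}_j(\mathbf{G})^\alpha_\alpha$) is the column (resp. row) determinant of the principal submatrix $\mathbf{G}^\beta_\beta$ taken at the column (resp. row) coming from index $i$ (resp. $j$); for Hermitian $\mathbf{F}$, $|\mathbf{F}|^\alpha_\alpha=\det\mathbf{F}^\alpha_\alpha$. *)

theory Defs
  imports "Jordan_Normal_Form.DL_Submatrix" "HOL-Combinatorics.Permutations"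
begin

datatype quat = Quat (qre: real) (qi: real) (qj: real) (qk: real)

lemma quat_eqI: "qre a = qre b \<Longrightarrow> qi a = qi b \<Longrightarrow> qj a = qj b \<Longrightarrow> qk a = qk b \<Longrightarrow> a = b"
  by (cases a; cases b) simp

lemma quat_eq_iff: "a = b \<longleftrightarrow> qre a = qre b \<and> qi a = qi b \<and> qj a = qj b \<and> qk a = qk b"
  by (auto intro: quat_eqI)

definition qnorm2 :: "quat \<Rightarrow> real" where
  "qnorm2 q = (qre q)^2 + (qi q)^2 + (qj q)^2 + (qk q)^2"

lemma qnorm2_zero_iff: "qnorm2 q = 0 \<longleftrightarrow> q = Quat 0 0 0 0"
  unfolding qnorm2_def by (cases q) (auto simp: add_nonneg_eq_0_iff)

instantiation quat :: division_ring
begin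
definition "0 = Quat 0 0 0 0"
definition "1 = Quat 1 0 0 0"
definition "a + b = Quat (qre a + qre b) (qi a + qi b) (qj a + qj b) (qk a + qk b)"
definition "- a = Quat (- qre a) (- qi a) (- qj a) (- qk a)"
definition "a - b = Quat (qre a - qre b) (qi a - qi b) (qj a - qj b) (qk a - qk b)"
definition "a * b = Quat
   (qre a * qre b - qi a * qi b - qj a * qj b - qk a * qk b)
   (qre a * qi b + qi a * qre b + qj a * qk b - qk a * qj b)
   (qre a * qj b - qi a * qk b + qj a * qre b + qk a * qi b)
   (qre a * qk b + qi a * qj b - qj a * qi b + qk a * qre b)"
definition "inverse a = Quat (qre a / qnorm2 a) (- qi a / qnorm2 a) (- qj a / qnorm2 a) (- qk a / qnorm2 a)"
definition "divide a b = a * inverse (b::quat)"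
instance
proof
  fix a b c :: quat
  show "a + b + c = a + (b + c)" by (simp add: plus_quat_def)
  show "a + b = b + a" by (simp add: plus_quat_def)
  show "0 + a = a" by (simp add: plus_quat_def zero_quat_def)
  show "- a + a = 0" by (simp add: plus_quat_def zero_quat_def uminus_quat_def)
  show "a - b = a + - b" by (simp add: plus_quat_def minus_quat_def uminus_quat_def)
  show "a * b * c = a * (b * c)" by (simp add: times_quat_def algebra_simps)
  show "1 * a = a" by (simp add: times_quat_def one_quat_def)
  show "a * 1 = a" by (simp add: times_quat_def one_quat_def)
  show "(a + b) * c = a * c + b * c" by (simp add: times_quat_def plus_quat_def algebra_simps)
  show "a * (b + c) = a * b + a * c" by (simp add: times_quat_def plus_quat_def algebra_simps)
  show "(0::quat) \<noteq> 1" by (simp add: zero_quat_def one_quat_def)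
  show "inverse (0::quat) = 0" by (simp add: inverse_quat_def zero_quat_def qnorm2_def)
next
  fix a :: quat
  assume "a \<noteq> 0"
  then have n: "qnorm2 a \<noteq> 0" using qnorm2_zero_iff by (simp add: zero_quat_def)
  show "inverse a * a = 1"
    using n by (intro quat_eqI)
      (simp_all add: inverse_quat_def times_quat_def one_quat_def divide_simps,
       simp_all add: qnorm2_def power2_eq_square algebra_simps)
  show "a * inverse a = 1"
    using n by (intro quat_eqI)
      (simp_all add: inverse_quat_def times_quat_def one_quat_def divide_simps,
       simp_all add: qnorm2_def power2_eq_square algebra_simps)
qed (simp add: divide_quat_def)
end

definition qcnj :: "quat \<Rightarrow> quat" where
  "qcnj q = Quat (qre q) (- qi q) (- qj q) (- qk q)"

definition ctrans :: "quat mat \<Rightarrow> quat mat" where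
  "ctrans A = mat (dim_col A) (dim_row A) (\<lambda>(i,j). qcnj (A $$ (j,i)))"

definition mp_inv :: "quat mat \<Rightarrow> quat mat" where
  "mp_inv A = (THE X. X \<in> carrier_mat (dim_col A) (dim_row A) \<and>
      A * X * A = A \<and> X * A * X = X \<and> ctrans (A * X) = A * X \<and> ctrans (X * A) = X * A)"

definition proj_P :: "quat mat \<Rightarrow> quat mat" where
  "proj_P A = mp_inv A * A"

definition cols_indep :: "quat mat \<Rightarrow> nat set \<Rightarrow> bool" where
  "cols_indep A S \<longleftrightarrow> (\<forall>c :: nat \<Rightarrow> quat.
      (\<forall>i < dim_row A. (\<Sum>j\<in>S. A $$ (i,j) * c j) = 0) \<longrightarrow> (\<forall>j\<in>S. c j = 0))"

definition qrank :: "quat mat \<Rightarrow> nat" where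
  "qrank A = Max {card S | S. S \<subseteq> {..<dim_col A} \<and> cols_indep A S}"

definition row_repl :: "quat mat \<Rightarrow> nat \<Rightarrow> quat vec \<Rightarrow> quat mat" where
  "row_repl F i b = mat (dim_row F) (dim_col F) (\<lambda>(k,l). if k = i then b $ l else F $$ (k,l))"

definition col_repl :: "quat mat \<Rightarrow> nat \<Rightarrow> quat vec \<Rightarrow> quat mat" where
  "col_repl F j b = mat (dim_row F) (dim_col F) (\<lambda>(k,l). if l = j then b $ k else F $$ (k,l))"

definition cyc_len :: "(nat \<Rightarrow> nat) \<Rightarrow> nat \<Rightarrow> nat" where
  "cyc_len \<sigma> c = (LEAST k. 0 < k \<and> (\<sigma> ^^ k) c = c)"

definition cyc_prod :: "quat mat \<Rightarrow> (nat \<Rightarrow> nat) \<Rightarrow> nat \<Rightarrow> quat" where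
  "cyc_prod F \<sigma> c = prod_list (map (\<lambda>k. F $$ ((\<sigma> ^^ k) c, (\<sigma> ^^ Suc k) c)) [0..<cyc_len \<sigma> c])"

text \<open>Number of disjoint cycles of sigma on {0..<n} (fixed points included): one per cycle minimum.\<close>
definition n_cycles :: "(nat \<Rightarrow> nat) \<Rightarrow> nat \<Rightarrow> nat" where
  "n_cycles \<sigma> n = card {c. c < n \<and> (\<forall>k. c \<le> (\<sigma> ^^ k) c)}"

definition other_leaders :: "(nat \<Rightarrow> nat) \<Rightarrow> nat \<Rightarrow> nat \<Rightarrow> nat list" where
  "other_leaders \<sigma> n i = sorted_list_of_set
     {c. c < n \<and> (\<forall>k. c \<le> (\<sigma> ^^ k) c) \<and> (\<forall>k. (\<sigma> ^^ k) i \<noteq> c)}"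

definition rdet :: "nat \<Rightarrow> quat mat \<Rightarrow> quat" where
  "rdet i F = (let n = dim_row F in
     \<Sum>\<sigma> | \<sigma> permutes {..<n}. (-1) ^ (n - n_cycles \<sigma> n) *
        (cyc_prod F \<sigma> i * prod_list (map (cyc_prod F \<sigma>) (other_leaders \<sigma> n i))))"

definition cdet :: "nat \<Rightarrow> quat mat \<Rightarrow> quat" where
  "cdet j F = (let n = dim_row F in
     \<Sum>\<sigma> | \<sigma> permutes {..<n}. (-1) ^ (n - n_cycles \<sigma> n) *
        (prod_list (map (cyc_prod F \<sigma>) (rev (other_leaders \<sigma> n j))) * cyc_prod F \<sigma> j))"

text \<open>Determinant of a Hermitian matrix (all row/column determinants coincide);
  the empty matrix has determinant 1.\<close>
definition hdet :: "quat mat \<Rightarrow> quat" where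
  "hdet F = (if dim_row F = 0 then 1 else rdet 0 F)"

text \<open>L_{k,n}: strictly increasing sequences of length k in {1..n}, represented (0-based) as
  k-element subsets of {0..<n}.\<close>
definition Lkn :: "nat \<Rightarrow> nat \<Rightarrow> nat set set" where
  "Lkn k n = {\<alpha>. \<alpha> \<subseteq> {..<n} \<and> card \<alpha> = k}"

definition Lkn_with :: "nat \<Rightarrow> nat \<Rightarrow> nat \<Rightarrow> nat set set" where
  "Lkn_with k n i = {\<alpha> \<in> Lkn k n. i \<in> \<alpha>}"

text \<open>rdet_j (G)^alpha_alpha and cdet_i (G)^beta_beta: row/column determinant of the principal
  submatrix, taken at the position that index j (resp. i) has inside alpha (resp. beta).\<close>
definition rdet_minor :: "nat \<Rightarrow> quat mat \<Rightarrow> nat set \<Rightarrow> quat" where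
  "rdet_minor j G \<alpha> = rdet (card {a \<in> \<alpha>. a < j}) (submatrix G \<alpha> \<alpha>)"

definition cdet_minor :: "nat \<Rightarrow> quat mat \<Rightarrow> nat set \<Rightarrow> quat" where
  "cdet_minor i G \<beta> = cdet (card {a \<in> \<beta>. a < i}) (submatrix G \<beta> \<beta>)"

definition hdet_minor :: "quat mat \<Rightarrow> nat set \<Rightarrow> quat" where
  "hdet_minor F \<alpha> = hdet (submatrix F \<alpha> \<alpha>)"

end

theory Submission
  imports Defs "HOL-Combinatorics.Cycles"
begin

text \<open>Let \<open>H = A\<^sup>* A\<close>, let \<open>d\<^sub>k\<close> be the sum of its principal minors of order \<open>k\<close>, and let
  \<open>l\<^sub>k\<close> be the vector whose \<open>g\<close>-th entry is the sum of the column determinants of order \<open>k\<close>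
  after \<open>c\<close> has been put into column \<open>g\<close>. Splitting the cycle through \<open>g\<close> off each permutation
  writes \<open>l\<^sub>k\<close> as a signed sum over paths, and a cancellation argument gives
  \<open>l\<^bsub>k+1\<^esub> + H l\<^sub>k = d\<^sub>k c\<close>, which is Cramer's rule for \<open>\<lambda>I + H\<close> compared coefficientwise.
  Hence \<open>l\<^sub>k = L\<^sub>k c\<close> with \<open>L\<^sub>k\<close> a real polynomial in \<open>H\<close>. If \<open>q\<close> is the largest index with
  \<open>d\<^sub>q \<noteq> 0\<close>, descending induction from \<open>L\<^bsub>n+1\<^esub> = 0\<close> yields \<open>L\<^bsub>q+1\<^esub> H = 0\<close>, so
  \<open>H L\<^sub>q H = d\<^sub>q H\<close> and \<open>d\<^sub>q\<^sup>-\<^sup>1 L\<^sub>q A\<^sup>*\<close> is the Moore--Penrose inverse of \<open>A\<close>. Comparing the real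
  traces of the projection \<open>A\<^sup>\<dagger> A\<close> shows \<open>q = rank A\<close>. The row formula follows by conjugate
  transposition.\<close>

section \<open>Splitting a cycle off a permutation\<close>

text \<open>Because quaternions do not commute, the usual multilinear calculus of determinants
  cannot be applied to these minors. What replaces it is that a replaced column lies on a single
  cycle. All other cycles live on a Hermitian principal submatrix, and summed over all permutations
  of their support they give a real number, which commutes with everything. A minor becomes a sum of
  real weights times products along one path, and the prescribed order of the cycles ceases to
  matter.

  The index q is defined by minors alone, and the empty minor d_0 = 1 makes it exist. Its
  identification with the rank uses no relation between single minors and independent columns: the
  trace of L_q H counts every minor of order q exactly q times, while the trace of an idempotent
  counts independent columns. Only real parts of traces occur, since the quaternionic trace itself
  is not cyclic.\<close>

definition path_prod :: "(nat \<Rightarrow> nat \<Rightarrow> quat) \<Rightarrow> nat list \<Rightarrow> quat" where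
  "path_prod f xs = prod_list (map2 f xs (tl xs))"

lemma path_prod_simps [simp]:
  "path_prod f [] = 1" "path_prod f [x] = 1"
  "path_prod f (x # y # zs) = f x y * path_prod f (y # zs)"
  by (simp_all add: path_prod_def)

lemma path_prod_append:
  "path_prod f (xs @ y # ys) = path_prod f (xs @ [y]) * path_prod f (y # ys)"
proof (induction xs)
  case (Cons x xs)
  then show ?case by (cases xs) (simp_all add: mult.assoc)
qed simp

lemma path_prod_cong:
  assumes "\<And>x y. x \<in> set xs \<Longrightarrow> y \<in> set (tl xs) \<Longrightarrow> f x y = g x y"
  shows "path_prod f xs = path_prod g xs"
proof -
  have "map2 f xs (tl xs) = map2 g xs (tl xs)"
    by (rule map_cong) (use assms in \<open>auto dest: set_zip_leftD set_zip_rightD\<close>)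
  then show ?thesis by (simp only: path_prod_def)
qed

lemma path_prod_map: "path_prod f (map h xs) = path_prod (\<lambda>i j. f (h i) (h j)) xs"
  by (induction xs rule: induct_list012) simp_all

text \<open>A cycle through a fixed index \<open>a\<close> of \<open>S\<close> corresponds to
  exactly one such list over \<open>S - {a}\<close>: its entries after \<open>a\<close> in order,
  with the empty list for a fixed point.\<close>

definition dist_lists :: "nat set \<Rightarrow> nat list set" where
  "dist_lists S = {u. distinct u \<and> set u \<subseteq> S}"

lemma finite_dist_lists [simp]: "finite S \<Longrightarrow> finite (dist_lists S)"
  unfolding dist_lists_def
  by (rule finite_subset[OF _ finite_subset_distinct[of S]]) auto

text \<open>The minimum of an orbit represents its cycle, so the cardinality counts cycles, fixed
  points included. The set \<open>S\<close> is arbitrary because deleting a cycle from an initial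
  segment leaves a general finite set.\<close>

definition cycle_leaders :: "(nat \<Rightarrow> nat) \<Rightarrow> nat set \<Rightarrow> nat set" where
  "cycle_leaders \<sigma> S = {c \<in> S. \<forall>k. c \<le> (\<sigma> ^^ k) c}"

definition cycle_prod :: "(nat \<Rightarrow> nat \<Rightarrow> quat) \<Rightarrow> (nat \<Rightarrow> nat) \<Rightarrow> nat \<Rightarrow> quat" where
  "cycle_prod f \<sigma> c = prod_list (map (\<lambda>k. f ((\<sigma> ^^ k) c) ((\<sigma> ^^ Suc k) c)) [0..<cyc_len \<sigma> c])"

text \<open>\<open>cs\<close> lists one cycle of \<sigma> from a chosen start, and \<rho> acts on
  the remaining indices. The start \<open>hd cs\<close> will be either the index at which a
  determinant is taken or the minimum of the index set.\<close>

locale cycle_split =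
  fixes S :: "nat set" and cs :: "nat list" and \<rho> \<sigma> :: "nat \<Rightarrow> nat"
  assumes fin: "finite S" and dist: "distinct cs" and ne: "cs \<noteq> []"
    and sub: "set cs \<subseteq> S" and perm: "\<rho> permutes S - set cs"
    and split: "\<sigma> = cycle_of_list cs \<circ> \<rho>"
begin

lemma split_apply: "\<sigma> x = cycle_of_list cs (\<rho> x)"
  by (simp add: split)

lemma permutes: "\<sigma> permutes S"
proof -
  have "cycle_of_list cs permutes S"
    using cycle_permutes sub by (rule permutes_subset)
  moreover have "\<rho> permutes S"
    using perm by (rule permutes_subset) auto
  ultimately show ?thesis unfolding split by (rule permutes_compose[rotated])
qed

lemma funpow_cycle:
  assumes "c \<in> set cs"
  shows "(\<sigma> ^^ k) c = (cycle_of_list cs ^^ k) c"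
proof (induction k)
  case (Suc k)
  have "(cycle_of_list cs ^^ k) c \<in> set cs"
    unfolding permutes_in_image[OF permutes_funpow[OF cycle_permutes]] by (rule assms)
  then have "\<rho> ((cycle_of_list cs ^^ k) c) = (cycle_of_list cs ^^ k) c"
    by (intro permutes_not_in[OF perm]) simp
  then show ?case by (simp add: split_apply[of "(cycle_of_list cs ^^ k) c"] Suc)
qed simp

lemma funpow_rest:
  assumes "c \<notin> set cs"
  shows "(\<sigma> ^^ k) c = (\<rho> ^^ k) c"
proof (induction k)
  case (Suc k)
  have "\<rho> permutes - set cs"
    using perm by (rule permutes_subset) auto
  then have "(\<rho> ^^ Suc k) c \<in> - set cs"
    unfolding permutes_in_image[OF permutes_funpow[OF \<open>\<rho> permutes - set cs\<close>]] using assms by simp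
  then have "cycle_of_list cs ((\<rho> ^^ Suc k) c) = (\<rho> ^^ Suc k) c"
    by (intro id_outside_supp) simp
  then show ?case by (simp add: split_apply[of "(\<rho> ^^ k) c"] Suc)
qed simp

lemma funpow_nth: "i < length cs \<Longrightarrow> (\<sigma> ^^ k) (cs ! i) = cs ! ((k + i) mod length cs)"
proof -
  assume i: "i < length cs"
  have "(\<sigma> ^^ k) (cs ! i) = map (cycle_of_list cs ^^ k) cs ! i"
    using i by (simp add: funpow_cycle)
  also have "\<dots> = cs ! ((k + i) mod length cs)"
    using i by (simp add: cyclic_rotation[OF dist] nth_rotate)
  finally show ?thesis .
qed

lemma orbit: 
  assumes "c \<in> set cs"
  shows "range (\<lambda>k. (\<sigma> ^^ k) c) = set cs"
proof (intro equalityI subsetI)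
  fix x assume "x \<in> range (\<lambda>k. (\<sigma> ^^ k) c)"
  then show "x \<in> set cs"
    using assms ne by (auto simp: in_set_conv_nth[of c] funpow_nth)
next
  fix x assume "x \<in> set cs"
  then obtain j where j: "j < length cs" "x = cs ! j" by (auto simp: in_set_conv_nth)
  obtain i where i: "i < length cs" "c = cs ! i" using assms by (auto simp: in_set_conv_nth)
  \<comment> \<open>From position \<open>i\<close>, \<open>length cs - i\<close> steps wrap around
    to position 0, and \<open>j\<close> further steps reach \<open>x\<close>.\<close>
  have "(\<sigma> ^^ (j + (length cs - i))) c = x"
    using i j by (simp add: funpow_nth)
  then show "x \<in> range (\<lambda>k. (\<sigma> ^^ k) c)" by blast
qed

lemma cyc_len_hd: "cyc_len \<sigma> (hd cs) = length cs"
proof -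
  have *: "(\<sigma> ^^ k) (hd cs) = hd cs \<longleftrightarrow> k mod length cs = 0" for k
    using funpow_nth[of 0 k] ne nth_eq_iff_index_eq[OF dist, of "k mod length cs" 0]
    by (simp add: hd_conv_nth)
  show ?thesis
    unfolding cyc_len_def *
    by (rule Least_equality) (use ne in \<open>auto intro: dvd_imp_le\<close>)
qed

lemma cycle_prod_hd: "cycle_prod f \<sigma> (hd cs) = path_prod f (cs @ [hd cs])"
proof -
  obtain a u where cs: "cs = a # u" using ne by (cases cs) auto
  have h: "(\<sigma> ^^ k) (hd cs) = cs ! (k mod length cs)" for k
    using funpow_nth[of 0 k] ne by (simp add: hd_conv_nth)
  have "zip ((a # u) @ [a]) ((u @ [a]) @ []) = zip (a # u) (u @ [a]) @ zip [a] []"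
    by (rule zip_append) simp
  then have "map2 f (cs @ [hd cs]) (tl (cs @ [hd cs])) = map2 f cs (rotate1 cs)"
    unfolding cs by simp
  also have "\<dots> = map (\<lambda>k. f ((\<sigma> ^^ k) (hd cs)) ((\<sigma> ^^ Suc k) (hd cs))) [0..<cyc_len \<sigma> (hd cs)]"
    by (rule nth_equalityI)
      (simp_all add: cyc_len_hd h nth_rotate1 del: funpow.simps)
  finally show ?thesis by (simp only: cycle_prod_def path_prod_def)
qed

lemma cycle_prod_rest: "c \<notin> set cs \<Longrightarrow> cycle_prod f \<sigma> c = cycle_prod f \<rho> c"
  unfolding cycle_prod_def cyc_len_def by (simp only: funpow_rest not_False_eq_True)

lemma leaders: "cycle_leaders \<sigma> S = insert (Min (set cs)) (cycle_leaders \<rho> (S - set cs))"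
proof -
  have in_cs: "(\<forall>k. c \<le> (\<sigma> ^^ k) c) \<longleftrightarrow> c = Min (set cs)" if "c \<in> set cs" for c
  proof -
    have "(\<forall>k. c \<le> (\<sigma> ^^ k) c) \<longleftrightarrow> (\<forall>x \<in> set cs. c \<le> x)"
      unfolding orbit[OF that, symmetric] by blast
    also have "\<dots> \<longleftrightarrow> c = Min (set cs)"
      using that by (auto intro: Min_eqI[symmetric])
    finally show ?thesis .
  qed
  have rest: "(\<forall>k. c \<le> (\<sigma> ^^ k) c) \<longleftrightarrow> (\<forall>k. c \<le> (\<rho> ^^ k) c)" if "c \<notin> set cs" for c
    by (simp only: funpow_rest[OF that])
  have Min: "Min (set cs) \<in> set cs" using ne by simp
  show ?thesis
  proof (rule Set.set_eqI)
    fix c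
    show "c \<in> cycle_leaders \<sigma> S \<longleftrightarrow> c \<in> insert (Min (set cs)) (cycle_leaders \<rho> (S - set cs))"
    proof (cases "c \<in> set cs")
      case True
      then show ?thesis
        unfolding cycle_leaders_def mem_Collect_eq insert_iff Diff_iff in_cs[OF True] using sub by blast
    next
      case False
      then have "c \<noteq> Min (set cs)" using Min by blast
      then show ?thesis
        unfolding cycle_leaders_def mem_Collect_eq insert_iff Diff_iff rest[OF False] using False by blast
    qed
  qed
qed

text \<open>The orbit of \<open>hd cs\<close> is \<open>set cs\<close>, so dropping the leader on it
  leaves precisely the cycles of \<rho>. This is the set that orders the remaining factors in
  \<open>rdet\<close> and \<open>cdet\<close>.\<close>

lemma other_leaders: "{c \<in> cycle_leaders \<sigma> S. \<forall>k. (\<sigma> ^^ k) (hd cs) \<noteq> c} = cycle_leaders \<rho> (S - set cs)"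
proof -
  have "{c. \<forall>k. (\<sigma> ^^ k) (hd cs) \<noteq> c} = - range (\<lambda>k. (\<sigma> ^^ k) (hd cs))"
    unfolding image_def by auto
  also have "\<dots> = - set cs"
    using orbit[of "hd cs"] ne by simp
  finally have "{c \<in> cycle_leaders \<sigma> S. \<forall>k. (\<sigma> ^^ k) (hd cs) \<noteq> c} = cycle_leaders \<sigma> S - set cs"
    by (simp only: set_eq_iff mem_Collect_eq Compl_iff Diff_iff) simp
  then show ?thesis
    unfolding leaders using ne by (auto simp: cycle_leaders_def)
qed

lemma leaders_finite: "finite (cycle_leaders \<rho> (S - set cs))"
  using fin by (simp add: cycle_leaders_def)

lemma leaders_disj: "Min (set cs) \<notin> cycle_leaders \<rho> (S - set cs)"
  using ne by (simp add: cycle_leaders_def)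

text \<open>Size minus number of cycles is additive, and a cycle of length l contributes l - 1.
  Truncated subtraction does no harm, since the leaders form a subset of the index set.\<close>

lemma sign_exponent:
  "card S - card (cycle_leaders \<sigma> S)
     = (length cs - 1) + (card (S - set cs) - card (cycle_leaders \<rho> (S - set cs)))"
proof -
  have "card (cycle_leaders \<sigma> S) = Suc (card (cycle_leaders \<rho> (S - set cs)))"
    unfolding leaders using leaders_finite leaders_disj by simp
  moreover have "card S = length cs + card (S - set cs)"
    using fin sub dist card_mono[OF fin sub] by (simp add: card_Diff_subset distinct_card)
  moreover have "card (cycle_leaders \<rho> (S - set cs)) \<le> card (S - set cs)"
    by (rule card_mono) (use fin in \<open>auto simp: cycle_leaders_def\<close>)
  ultimately show ?thesis using ne by (cases cs) auto
qed

end

lemma cyc_len_eq_least_power: "cyc_len \<sigma> c = least_power \<sigma> c"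
  by (simp add: cyc_len_def least_power_def conj_commute)

text \<open>Iterating a permutation from \<open>a\<close> returns the cycle through
  \<open>a\<close>, listed by \<open>support\<close>, and restricting the permutation to the
  complement returns \<rho>. These two readings invert the composition.\<close>

lemma sum_permutes_split:
  fixes g :: "(nat \<Rightarrow> nat) \<Rightarrow> 'b::comm_monoid_add"
  assumes S: "finite S" and a: "a \<in> S"
  shows "(\<Sum>\<sigma> | \<sigma> permutes S. g \<sigma>)
    = (\<Sum>u \<in> dist_lists (S - {a}). \<Sum>\<rho> | \<rho> permutes S - set (a # u). g (cycle_of_list (a # u) \<circ> \<rho>))"
proof -
  let ?j = "\<lambda>\<sigma>. (tl (support \<sigma> a), \<lambda>y. if y \<in> S - set (support \<sigma> a) then \<sigma> y else y)"
  let ?i = "\<lambda>(u, \<rho>). cycle_of_list (a # u) \<circ> \<rho>"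
  let ?B = "Sigma (dist_lists (S - {a})) (\<lambda>u. {\<rho>. \<rho> permutes S - set (a # u)})"
  have split: "cycle_split S (a # u) \<rho> (cycle_of_list (a # u) \<circ> \<rho>)" if "(u, \<rho>) \<in> ?B" for u \<rho>
    using that S a by unfold_locales (auto simp: dist_lists_def)
  have supp: "support \<sigma> a = a # tl (support \<sigma> a)" "distinct (support \<sigma> a)"
      "set (support \<sigma> a) \<subseteq> S" and perm: "permutation \<sigma>" if "\<sigma> permutes S" for \<sigma>
  proof -
    show p: "permutation \<sigma>" using that S permutation_permutes by blast
    then show "distinct (support \<sigma> a)" by (rule cycle_of_permutation)
    have "least_power \<sigma> a > 0" using least_power_of_permutation[OF p] by blast
    then show "support \<sigma> a = a # tl (support \<sigma> a)"
      by (simp add: upt_conv_Cons)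
    show "set (support \<sigma> a) \<subseteq> S"
      using permutes_in_image[OF permutes_funpow[OF that]] a by auto
  qed
  have "(\<Sum>\<sigma> | \<sigma> permutes S. g \<sigma>) = (\<Sum>x \<in> ?B. g (?i x))"
  proof (rule sum.reindex_bij_witness[where i = ?i and j = ?j])
    fix \<sigma> assume "\<sigma> \<in> {\<sigma>. \<sigma> permutes S}"
    then have \<sigma>: "\<sigma> permutes S" by simp
    note s = supp[OF \<sigma>]
    show inv: "?i (?j \<sigma>) = \<sigma>"
    proof
      fix x
      have "\<sigma> x \<notin> set (support \<sigma> a)" if "x \<notin> set (support \<sigma> a)"
      proof
        assume "\<sigma> x \<in> set (support \<sigma> a)"
        moreover have "\<sigma> x \<in> set (support \<sigma> x)"
          unfolding support_set[OF perm[OF \<sigma>]] by (rule range_eqI[of _ _ 1]) simp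
        ultimately show False
          using that disjoint_support'[OF perm[OF \<sigma>], of x a] by blast
      qed
      then show "?i (?j \<sigma>) x = \<sigma> x"
        unfolding prod.case comp_apply s(1)[symmetric]
        using cycle_restrict[OF perm[OF \<sigma>], of x a] subsetD[OF s(3), of x] permutes_not_in[OF \<sigma>, of x]
        by (cases "x \<in> set (support \<sigma> a)"; cases "x \<in> S") (simp_all add: id_outside_supp del: set_map)
    qed
    obtain u where u: "support \<sigma> a = a # u" by (rule that[OF s(1)])
    show "?j \<sigma> \<in> ?B"
      using semidecomposition[OF \<sigma> S, of a] s(2,3)
      unfolding u by (auto simp: dist_lists_def)
    show "g (?i (?j \<sigma>)) = g \<sigma>" using inv by simp
  next
    fix x assume x: "x \<in> ?B"
    obtain u \<rho> where x_def: "x = (u, \<rho>)" by force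
    interpret cycle_split S "a # u" \<rho> "cycle_of_list (a # u) \<circ> \<rho>" using split x x_def by blast
    show "?i x \<in> {\<sigma>. \<sigma> permutes S}" using permutes x_def by simp
    let ?\<sigma> = "cycle_of_list (a # u) \<circ> \<rho>"
    have "support ?\<sigma> a = map (\<lambda>i. (a # u) ! i) [0..<length (a # u)]"
      using cyc_len_hd funpow_nth[of 0]
      by (auto simp: cyc_len_eq_least_power)
    then have s: "support ?\<sigma> a = a # u" by (metis map_nth)
    have "(\<lambda>y. if y \<in> S - set (a # u) then ?\<sigma> y else y) = \<rho>"
      using perm funpow_rest[of _ 1] by (auto simp: permutes_not_in)
    then show "?j (?i x) = x" unfolding x_def prod.case s by simp
  qed
  also have "\<dots> = (\<Sum>u \<in> dist_lists (S - {a}). \<Sum>\<rho> | \<rho> permutes S - set (a # u). g (cycle_of_list (a # u) \<circ> \<rho>))"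
    by (subst sum.Sigma) (use S in \<open>auto simp: finite_permutations case_prod_unfold\<close>)
  finally show ?thesis .
qed

section \<open>Row and column determinants as sums over closed paths\<close>

definition qreal :: "real \<Rightarrow> quat" where
  "qreal x = Quat x 0 0 0"

lemmas quat_arith_defs = zero_quat_def one_quat_def plus_quat_def minus_quat_def uminus_quat_def
  times_quat_def qcnj_def qreal_def

lemma qcnj_simps [simp]:
  "qcnj 0 = 0" "qcnj 1 = 1" "qcnj (a + b) = qcnj a + qcnj b" "qcnj (a - b) = qcnj a - qcnj b"
  "qcnj (- a) = - qcnj a" "qcnj (qcnj a) = a" "qcnj (qreal x) = qreal x"
  by (simp_all add: quat_arith_defs)

lemma qcnj_mult [simp]: "qcnj (a * b) = qcnj b * qcnj a"
  by (simp add: quat_arith_defs algebra_simps)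

lemma qcnj_sum [simp]: "qcnj (\<Sum>x\<in>A. f x) = (\<Sum>x\<in>A. qcnj (f x))"
  by (induction A rule: infinite_finite_induct) simp_all

lemma qreal_simps:
  "qreal 0 = 0" "qreal 1 = 1" "qreal (x + y) = qreal x + qreal y" "qreal (x - y) = qreal x - qreal y"
  "qreal (- x) = - qreal x" "qreal (x * y) = qreal x * qreal y"
  by (simp_all add: quat_arith_defs)

lemma qreal_sum: "qreal (\<Sum>x\<in>A. f x) = (\<Sum>x\<in>A. qreal (f x))"
  by (induction A rule: infinite_finite_induct) (simp_all add: qreal_simps)

lemma qreal_power_minus_1: "qreal ((- 1) ^ n) = (- 1) ^ n"
  by (induction n) (simp_all add: qreal_simps)

lemma qreal_commute: "a * qreal x = qreal x * a"
  by (simp add: quat_arith_defs)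

lemma inverse_qreal: "inverse (qreal x) = qreal (inverse x)"
  by (simp add: inverse_quat_def qreal_def qnorm2_def power2_eq_square inverse_eq_divide)

lemma qre_simps [simp]:
  "qre 0 = 0" "qre 1 = 1" "qre (a + b) = qre a + qre b" "qre (a - b) = qre a - qre b"
  "qre (- a) = - qre a" "qre (qcnj a) = qre a" "qre (qreal x) = x" "qre (qreal x * a) = x * qre a"
  by (simp_all add: quat_arith_defs)

lemma qre_sum [simp]: "qre (\<Sum>x\<in>A. f x) = (\<Sum>x\<in>A. qre (f x))"
  by (induction A rule: infinite_finite_induct) simp_all

lemma qre_mult_commute: "qre (a * b) = qre (b * a)"
  by (simp add: times_quat_def)

lemma qcnj_fixed_iff: "qcnj a = a \<longleftrightarrow> a = qreal (qre a)"
  by (cases a) (auto simp: qcnj_def qreal_def)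

text \<open>A cycle product changes with its starting index, but
  \<open>qre (x * y) = qre (y * x)\<close> makes its real part invariant under rotation.\<close>

lemma qre_path_prod_rotate:
  assumes "cs \<noteq> []" "ds \<noteq> []"
  shows "qre (path_prod f (cs @ ds @ [hd cs])) = qre (path_prod f (ds @ cs @ [hd ds]))"
proof -
  obtain a xs where cs: "cs = a # xs" using assms by (cases cs) auto
  obtain b ys where ds: "ds = b # ys" using assms by (cases ds) auto
  have "path_prod f (cs @ ds @ [hd cs]) = path_prod f (a # xs @ [b]) * path_prod f (b # ys @ [a])"
    using path_prod_append[of f "a # xs" b "ys @ [a]"] by (simp add: cs ds)
  moreover have "path_prod f (ds @ cs @ [hd ds]) = path_prod f (b # ys @ [a]) * path_prod f (a # xs @ [b])"
    using path_prod_append[of f "b # ys" a "xs @ [b]"] by (simp add: cs ds)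
  ultimately show ?thesis by (simp add: qre_mult_commute)
qed

text \<open>The common value of all row and column determinants of a Hermitian \<open>f\<close> on the index set
  \<open>S\<close>: only real parts of cycle products survive, because a cycle and its inverse contribute
  conjugate terms.\<close>
definition herm_det :: "(nat \<Rightarrow> nat \<Rightarrow> quat) \<Rightarrow> nat set \<Rightarrow> real" where
  "herm_det f S = (\<Sum>\<sigma> | \<sigma> permutes S.
     (-1) ^ (card S - card (cycle_leaders \<sigma> S)) * (\<Prod>c \<in> cycle_leaders \<sigma> S. qre (cycle_prod f \<sigma> c)))"

lemma (in cycle_split) qre_cycle_prod_Min:
  "qre (cycle_prod f \<sigma> (Min (set cs))) = qre (path_prod f (cs @ [hd cs]))"
proof -
  obtain xs ys where cs: "cs = xs @ Min (set cs) # ys"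
    using split_list[OF Min_in[of "set cs"]] ne by auto
  define m where "m = Min (set cs)"
  have cs: "cs = xs @ m # ys" using cs by (simp add: m_def)
  have rot: "m # ys @ xs = rotate (length xs) cs"
    by (simp add: cs rotate_append)
  \<comment> \<open>Rotating the list leaves the permutation unchanged and only moves the start of
    the cycle to its minimum.\<close>
  interpret r: cycle_split S "m # ys @ xs" \<rho> \<sigma>
    using fin dist ne sub perm split cycle_of_list_rotate_independent[OF dist, of "length xs"]
    unfolding rot by unfold_locales auto
  have "qre (cycle_prod f \<sigma> m) = qre (path_prod f ((m # ys @ xs) @ [m]))"
    using r.cycle_prod_hd[of f] by simp
  also have "\<dots> = qre (path_prod f (cs @ [hd cs]))"
  proof (cases xs)
    case (Cons x xs')
    then show ?thesis using qre_path_prod_rotate[of "m # ys" xs f] by (simp add: cs)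
  qed (simp add: cs)
  finally show ?thesis by (simp add: m_def)
qed

lemma cycle_splitI:
  assumes "finite S" "a \<in> S" "u \<in> dist_lists (S - {a})" "\<rho> permutes S - set (a # u)"
  shows "cycle_split S (a # u) \<rho> (cycle_of_list (a # u) \<circ> \<rho>)"
  using assms by unfold_locales (auto simp: dist_lists_def)

text \<open>Real factors commute and real parts ignore where a cycle starts, so the expansion may be
  made at any \<open>a\<close>; the ordered products below are expanded only at the minimum.\<close>

lemma herm_det_expand:
  assumes S: "finite S" "a \<in> S"
  shows "herm_det f S = (\<Sum>u \<in> dist_lists (S - {a}).
    (-1) ^ length u * herm_det f (S - set (a # u)) * qre (path_prod f (a # u @ [a])))"
  unfolding herm_det_def[of f S] sum_permutes_split[OF S]
proof (rule sum.cong[OF refl])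
  fix u assume u: "u \<in> dist_lists (S - {a})"
  let ?\<sigma> = "\<lambda>\<rho>. cycle_of_list (a # u) \<circ> \<rho>"
  let ?R = "S - set (a # u)"
  have "(-1) ^ (card S - card (cycle_leaders (?\<sigma> \<rho>) S))
          * (\<Prod>c \<in> cycle_leaders (?\<sigma> \<rho>) S. qre (cycle_prod f (?\<sigma> \<rho>) c))
      = (-1) ^ length u * qre (path_prod f (a # u @ [a])) *
        ((-1) ^ (card ?R - card (cycle_leaders \<rho> ?R)) * (\<Prod>c \<in> cycle_leaders \<rho> ?R. qre (cycle_prod f \<rho> c)))"
    if "\<rho> permutes ?R" for \<rho>
  proof -
    define \<sigma> where "\<sigma> = ?\<sigma> \<rho>"
    interpret cycle_split S "a # u" \<rho> \<sigma>
      unfolding \<sigma>_def using S u that by (rule cycle_splitI)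
    have "(\<Prod>c \<in> cycle_leaders \<rho> ?R. qre (cycle_prod f \<sigma> c)) = (\<Prod>c \<in> cycle_leaders \<rho> ?R. qre (cycle_prod f \<rho> c))"
      by (rule prod.cong) (auto simp: cycle_prod_rest cycle_leaders_def)
    then have "(\<Prod>c \<in> cycle_leaders \<sigma> S. qre (cycle_prod f \<sigma> c))
        = qre (path_prod f (a # u @ [a])) * (\<Prod>c \<in> cycle_leaders \<rho> ?R. qre (cycle_prod f \<rho> c))"
      unfolding leaders prod.insert[OF leaders_finite leaders_disj] qre_cycle_prod_Min by simp
    then show ?thesis
      unfolding \<sigma>_def[symmetric] sign_exponent by (simp add: power_add)
  qed
  then show "(\<Sum>\<rho> | \<rho> permutes ?R. (-1) ^ (card S - card (cycle_leaders (?\<sigma> \<rho>) S))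
          * (\<Prod>c \<in> cycle_leaders (?\<sigma> \<rho>) S. qre (cycle_prod f (?\<sigma> \<rho>) c)))
      = (-1) ^ length u * herm_det f ?R * qre (path_prod f (a # u @ [a]))"
    unfolding herm_det_def by (simp add: sum_distrib_left mult_ac)
qed

lemma herm_det_empty [simp]: "herm_det f {} = 1"
  by (simp add: herm_det_def cycle_leaders_def)

text \<open>Products over the cycles in increasing order of their leaders, for row determinants, and
  in decreasing order, for column determinants.\<close>
definition asc_det :: "(nat \<Rightarrow> nat \<Rightarrow> quat) \<Rightarrow> nat set \<Rightarrow> quat" where
  "asc_det f S = (\<Sum>\<sigma> | \<sigma> permutes S. (-1) ^ (card S - card (cycle_leaders \<sigma> S)) *
     prod_list (map (cycle_prod f \<sigma>) (sorted_list_of_set (cycle_leaders \<sigma> S))))"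

definition desc_det :: "(nat \<Rightarrow> nat \<Rightarrow> quat) \<Rightarrow> nat set \<Rightarrow> quat" where
  "desc_det f S = (\<Sum>\<sigma> | \<sigma> permutes S. (-1) ^ (card S - card (cycle_leaders \<sigma> S)) *
     prod_list (map (cycle_prod f \<sigma>) (rev (sorted_list_of_set (cycle_leaders \<sigma> S)))))"

lemma cyc_prod_eq: "cyc_prod F = cycle_prod (\<lambda>i j. F $$ (i, j))"
  by (simp add: fun_eq_iff cyc_prod_def cycle_prod_def)

lemma other_leaders_eq:
  "other_leaders \<sigma> n i = sorted_list_of_set {c \<in> cycle_leaders \<sigma> {..<n}. \<forall>k. (\<sigma> ^^ k) i \<noteq> c}"
  unfolding other_leaders_def cycle_leaders_def by (rule arg_cong[where f = sorted_list_of_set]) auto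

lemma n_cycles_eq: "n_cycles \<sigma> n = card (cycle_leaders \<sigma> {..<n})"
  by (simp add: n_cycles_def cycle_leaders_def)

context cycle_split
begin

lemma map_cycle_prod_leaders:
  "map (cycle_prod f \<sigma>) (sorted_list_of_set (cycle_leaders \<rho> (S - set cs)))
    = map (cycle_prod f \<rho>) (sorted_list_of_set (cycle_leaders \<rho> (S - set cs)))"
  using leaders_finite by (auto simp: cycle_leaders_def cycle_prod_rest)

lemma sorted_leaders_Min:
  assumes "hd cs = Min S"
  shows "sorted_list_of_set (cycle_leaders \<sigma> S) = hd cs # sorted_list_of_set (cycle_leaders \<rho> (S - set cs))"
proof -
  have le: "hd cs \<le> x" if "x \<in> S" for x
    using that fin assms by simp
  have "Min (set cs) = hd cs"
    using ne sub le by (intro Min_eqI) auto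
  moreover have "hd cs \<notin> cycle_leaders \<rho> (S - set cs)"
    using ne by (simp add: cycle_leaders_def)
  ultimately show ?thesis
    unfolding leaders using leaders_finite le
    by (auto simp: sorted_list_of_set_insert intro!: insort_is_Cons simp: cycle_leaders_def)
qed

end

lemma power_minus_1_commute: "a * (- 1) ^ n = (- 1) ^ n * (a::'a::ring_1)"
  by (induction n) simp_all

text \<open>The cycle through \<open>Min S\<close> has the smallest leader and is therefore the last
  factor of the decreasing product; it splits off without moving one factor past another.\<close>

lemma desc_det_expand:
  assumes S: "finite S" "S \<noteq> {}"
  shows "desc_det f S = (\<Sum>u \<in> dist_lists (S - {Min S}). (-1) ^ length u *
    (desc_det f (S - set (Min S # u)) * path_prod f (Min S # u @ [Min S])))"
  unfolding desc_det_def[of f S] sum_permutes_split[OF S(1) Min_in[OF S]]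
proof (rule sum.cong[OF refl])
  fix u assume u: "u \<in> dist_lists (S - {Min S})"
  let ?\<sigma> = "\<lambda>\<rho>. cycle_of_list (Min S # u) \<circ> \<rho>"
  let ?R = "S - set (Min S # u)"
  have "(-1) ^ (card S - card (cycle_leaders (?\<sigma> \<rho>) S)) *
          prod_list (map (cycle_prod f (?\<sigma> \<rho>)) (rev (sorted_list_of_set (cycle_leaders (?\<sigma> \<rho>) S))))
      = (-1) ^ length u * ((-1) ^ (card ?R - card (cycle_leaders \<rho> ?R)) *
          prod_list (map (cycle_prod f \<rho>) (rev (sorted_list_of_set (cycle_leaders \<rho> ?R))))
          * path_prod f (Min S # u @ [Min S]))"
    if "\<rho> permutes ?R" for \<rho>
  proof -
    define \<sigma> where "\<sigma> = ?\<sigma> \<rho>"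
    interpret cycle_split S "Min S # u" \<rho> \<sigma>
      unfolding \<sigma>_def using S(1) Min_in[OF S] u that by (rule cycle_splitI)
    show ?thesis
      unfolding \<sigma>_def[symmetric] sign_exponent sorted_leaders_Min[OF list.sel(1)]
        rev_map[symmetric] list.map list.sel map_cycle_prod_leaders
      using cycle_prod_hd[of f]
      by (simp add: power_add mult.assoc)
  qed
  then show "(\<Sum>\<rho> | \<rho> permutes ?R. (-1) ^ (card S - card (cycle_leaders (?\<sigma> \<rho>) S)) *
          prod_list (map (cycle_prod f (?\<sigma> \<rho>)) (rev (sorted_list_of_set (cycle_leaders (?\<sigma> \<rho>) S)))))
      = (-1) ^ length u * (desc_det f ?R * path_prod f (Min S # u @ [Min S]))"
    unfolding desc_det_def by (simp add: sum_distrib_left sum_distrib_right)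
qed

lemma asc_det_expand:
  assumes S: "finite S" "S \<noteq> {}"
  shows "asc_det f S = (\<Sum>u \<in> dist_lists (S - {Min S}). (-1) ^ length u *
    (path_prod f (Min S # u @ [Min S]) * asc_det f (S - set (Min S # u))))"
  unfolding asc_det_def[of f S] sum_permutes_split[OF S(1) Min_in[OF S]]
proof (rule sum.cong[OF refl])
  fix u assume u: "u \<in> dist_lists (S - {Min S})"
  let ?\<sigma> = "\<lambda>\<rho>. cycle_of_list (Min S # u) \<circ> \<rho>"
  let ?R = "S - set (Min S # u)"
  let ?P = "path_prod f (Min S # u @ [Min S])"
  have "(-1) ^ (card S - card (cycle_leaders (?\<sigma> \<rho>) S)) *
          prod_list (map (cycle_prod f (?\<sigma> \<rho>)) (sorted_list_of_set (cycle_leaders (?\<sigma> \<rho>) S)))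
      = (-1) ^ length u * (?P * ((-1) ^ (card ?R - card (cycle_leaders \<rho> ?R)) *
          prod_list (map (cycle_prod f \<rho>) (sorted_list_of_set (cycle_leaders \<rho> ?R)))))"
    if "\<rho> permutes ?R" for \<rho>
  proof -
    define \<sigma> where "\<sigma> = ?\<sigma> \<rho>"
    interpret cycle_split S "Min S # u" \<rho> \<sigma>
      unfolding \<sigma>_def using S(1) Min_in[OF S] u that by (rule cycle_splitI)
    show ?thesis
      unfolding \<sigma>_def[symmetric] sign_exponent sorted_leaders_Min[OF list.sel(1)]
        rev_map[symmetric] list.map list.sel map_cycle_prod_leaders
        mult.assoc[symmetric] power_minus_1_commute[of ?P]
      using cycle_prod_hd[of f]
      by (simp add: power_add mult.assoc)
  qed
  then show "(\<Sum>\<rho> | \<rho> permutes ?R. (-1) ^ (card S - card (cycle_leaders (?\<sigma> \<rho>) S)) *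
          prod_list (map (cycle_prod f (?\<sigma> \<rho>)) (sorted_list_of_set (cycle_leaders (?\<sigma> \<rho>) S))))
      = (-1) ^ length u * (?P * asc_det f ?R)"
    unfolding asc_det_def by (simp add: sum_distrib_left)
qed

lemma cdet_expand:
  assumes i: "i < dim_row F"
  defines "f \<equiv> \<lambda>i j. F $$ (i, j)"
  shows "cdet i F = (\<Sum>u \<in> dist_lists ({..<dim_row F} - {i}). (-1) ^ length u *
    (desc_det f ({..<dim_row F} - set (i # u)) * path_prod f (i # u @ [i])))"
proof -
  define S where "S = {..<dim_row F}"
  have S: "finite S" "i \<in> S" using i by (simp_all add: S_def)
  have "cdet i F = (\<Sum>\<sigma> | \<sigma> permutes S. (-1) ^ (card S - card (cycle_leaders \<sigma> S)) *
      (prod_list (map (cycle_prod f \<sigma>) (rev (sorted_list_of_set {c \<in> cycle_leaders \<sigma> S. \<forall>k. (\<sigma> ^^ k) i \<noteq> c})))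
       * cycle_prod f \<sigma> i))"
    by (simp add: cdet_def Let_def S_def n_cycles_eq other_leaders_eq cyc_prod_eq f_def)
  also have "\<dots> = (\<Sum>u \<in> dist_lists (S - {i}). (-1) ^ length u *
    (desc_det f (S - set (i # u)) * path_prod f (i # u @ [i])))"
    unfolding sum_permutes_split[OF S]
  proof (rule sum.cong[OF refl])
    fix u assume u: "u \<in> dist_lists (S - {i})"
    let ?\<sigma> = "\<lambda>\<rho>. cycle_of_list (i # u) \<circ> \<rho>"
    let ?R = "S - set (i # u)"
    let ?O = "\<lambda>\<rho>. {c \<in> cycle_leaders (?\<sigma> \<rho>) S. \<forall>k. (?\<sigma> \<rho> ^^ k) i \<noteq> c}"
    have "(-1) ^ (card S - card (cycle_leaders (?\<sigma> \<rho>) S)) *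
          (prod_list (map (cycle_prod f (?\<sigma> \<rho>)) (rev (sorted_list_of_set (?O \<rho>)))) * cycle_prod f (?\<sigma> \<rho>) i)
      = (-1) ^ length u * ((-1) ^ (card ?R - card (cycle_leaders \<rho> ?R)) *
          prod_list (map (cycle_prod f \<rho>) (rev (sorted_list_of_set (cycle_leaders \<rho> ?R))))
          * path_prod f (i # u @ [i]))"
      if "\<rho> permutes ?R" for \<rho>
    proof -
      define \<sigma> where "\<sigma> = ?\<sigma> \<rho>"
      interpret cycle_split S "i # u" \<rho> \<sigma>
        unfolding \<sigma>_def using S u that by (rule cycle_splitI)
      show ?thesis
        unfolding \<sigma>_def[symmetric] sign_exponent other_leaders[unfolded list.sel(1)]
        rev_map[symmetric] list.map list.sel map_cycle_prod_leaders
        using cycle_prod_hd[of f]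
        by (simp add: power_add mult.assoc)
    qed
    then show "(\<Sum>\<rho> | \<rho> permutes ?R. (-1) ^ (card S - card (cycle_leaders (?\<sigma> \<rho>) S)) *
          (prod_list (map (cycle_prod f (?\<sigma> \<rho>)) (rev (sorted_list_of_set (?O \<rho>)))) * cycle_prod f (?\<sigma> \<rho>) i))
      = (-1) ^ length u * (desc_det f ?R * path_prod f (i # u @ [i]))"
      unfolding desc_det_def by (simp add: sum_distrib_left sum_distrib_right)
  qed
  finally show ?thesis by (simp add: S_def)
qed

lemma rdet_expand:
  assumes i: "i < dim_row F"
  defines "f \<equiv> \<lambda>i j. F $$ (i, j)"
  shows "rdet i F = (\<Sum>u \<in> dist_lists ({..<dim_row F} - {i}). (-1) ^ length u *
    (path_prod f (i # u @ [i]) * asc_det f ({..<dim_row F} - set (i # u))))"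
proof -
  define S where "S = {..<dim_row F}"
  have S: "finite S" "i \<in> S" using i by (simp_all add: S_def)
  have "rdet i F = (\<Sum>\<sigma> | \<sigma> permutes S. (-1) ^ (card S - card (cycle_leaders \<sigma> S)) *
      (cycle_prod f \<sigma> i *
       prod_list (map (cycle_prod f \<sigma>) (sorted_list_of_set {c \<in> cycle_leaders \<sigma> S. \<forall>k. (\<sigma> ^^ k) i \<noteq> c}))))"
    by (simp add: rdet_def Let_def S_def n_cycles_eq other_leaders_eq cyc_prod_eq f_def)
  also have "\<dots> = (\<Sum>u \<in> dist_lists (S - {i}). (-1) ^ length u *
    (path_prod f (i # u @ [i]) * asc_det f (S - set (i # u))))"
    unfolding sum_permutes_split[OF S]
  proof (rule sum.cong[OF refl])
    fix u assume u: "u \<in> dist_lists (S - {i})"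
    let ?\<sigma> = "\<lambda>\<rho>. cycle_of_list (i # u) \<circ> \<rho>"
    let ?R = "S - set (i # u)"
    let ?O = "\<lambda>\<rho>. {c \<in> cycle_leaders (?\<sigma> \<rho>) S. \<forall>k. (?\<sigma> \<rho> ^^ k) i \<noteq> c}"
    let ?P = "path_prod f (i # u @ [i])"
    have "(-1) ^ (card S - card (cycle_leaders (?\<sigma> \<rho>) S)) *
          (cycle_prod f (?\<sigma> \<rho>) i * prod_list (map (cycle_prod f (?\<sigma> \<rho>)) (sorted_list_of_set (?O \<rho>))))
      = (-1) ^ length u * (?P * ((-1) ^ (card ?R - card (cycle_leaders \<rho> ?R)) *
          prod_list (map (cycle_prod f \<rho>) (sorted_list_of_set (cycle_leaders \<rho> ?R)))))"
      if "\<rho> permutes ?R" for \<rho>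
    proof -
      define \<sigma> where "\<sigma> = ?\<sigma> \<rho>"
      interpret cycle_split S "i # u" \<rho> \<sigma>
        unfolding \<sigma>_def using S u that by (rule cycle_splitI)
      show ?thesis
        unfolding \<sigma>_def[symmetric] sign_exponent other_leaders[unfolded list.sel(1)]
        rev_map[symmetric] list.map list.sel map_cycle_prod_leaders
          mult.assoc[symmetric] power_minus_1_commute[of ?P]
        using cycle_prod_hd[of f]
        by (simp add: power_add mult.assoc)
    qed
    then show "(\<Sum>\<rho> | \<rho> permutes ?R. (-1) ^ (card S - card (cycle_leaders (?\<sigma> \<rho>) S)) *
          (cycle_prod f (?\<sigma> \<rho>) i * prod_list (map (cycle_prod f (?\<sigma> \<rho>)) (sorted_list_of_set (?O \<rho>)))))
      = (-1) ^ length u * (?P * asc_det f ?R)"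
      unfolding asc_det_def by (simp add: sum_distrib_left)
  qed
  finally show ?thesis by (simp add: S_def)
qed

section \<open>Determinants of Hermitian matrices\<close>

definition hermitian_on :: "nat set \<Rightarrow> (nat \<Rightarrow> nat \<Rightarrow> quat) \<Rightarrow> bool" where
  "hermitian_on S f \<longleftrightarrow> (\<forall>i\<in>S. \<forall>j\<in>S. f i j = qcnj (f j i))"

lemma hermitian_onI:
  "(\<And>i j. i \<in> S \<Longrightarrow> j \<in> S \<Longrightarrow> f i j = qcnj (f j i)) \<Longrightarrow> hermitian_on S f"
  unfolding hermitian_on_def by blast

lemma hermitian_onD: "hermitian_on S f \<Longrightarrow> i \<in> S \<Longrightarrow> j \<in> S \<Longrightarrow> f i j = qcnj (f j i)"
  unfolding hermitian_on_def by blast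

lemma hermitian_on_mono: "hermitian_on S f \<Longrightarrow> T \<subseteq> S \<Longrightarrow> hermitian_on T f"
  unfolding hermitian_on_def by blast

lemma path_prod_snoc: "path_prod f (xs @ [x, y]) = path_prod f (xs @ [x]) * f x y"
  using path_prod_append[of f xs x "[y]"] by simp

lemma qcnj_path_prod:
  assumes "\<And>x y. x \<in> set xs \<Longrightarrow> y \<in> set xs \<Longrightarrow> f x y = qcnj (g y x)"
  shows "qcnj (path_prod f xs) = path_prod g (rev xs)"
  using assms
proof (induction xs rule: induct_list012)
  case (3 x y zs)
  have "qcnj (path_prod f (y # zs)) = path_prod g (rev (y # zs))"
    using 3 by simp
  moreover have "qcnj (f x y) = g y x" using 3(3)[of x y] by simp
  ultimately show ?case by (simp add: path_prod_snoc)
qed simp_all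

text \<open>Conjugation reverses each closed path. Reversal permutes the lists and preserves the
  weight, which depends only on length and vertex set; being real, the weight also commutes.\<close>

lemma qcnj_sum_closed_paths:
  assumes a: "a \<in> S" and fg: "\<And>i j. i \<in> S \<Longrightarrow> j \<in> S \<Longrightarrow> f i j = qcnj (g j i)"
  shows "qcnj (\<Sum>u \<in> dist_lists (S - {a}). qreal (w (length u) (set u)) * path_prod f (a # u @ [a]))
    = (\<Sum>u \<in> dist_lists (S - {a}). qreal (w (length u) (set u)) * path_prod g (a # u @ [a]))"
proof -
  have "(\<Sum>u \<in> dist_lists (S - {a}). qreal (w (length u) (set u)) * path_prod g (a # rev u @ [a]))
    = (\<Sum>u \<in> dist_lists (S - {a}). qreal (w (length u) (set u)) * path_prod g (a # u @ [a]))"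
    by (rule sum.reindex_bij_witness[where i = rev and j = rev]) (auto simp: dist_lists_def)
  moreover have "qcnj (path_prod f (a # u @ [a])) = path_prod g (a # rev u @ [a])"
    if "u \<in> dist_lists (S - {a})" for u
  proof -
    have "set (a # u @ [a]) \<subseteq> S" using that a by (auto simp: dist_lists_def)
    then show ?thesis using qcnj_path_prod[of "a # u @ [a]" f g] fg by auto
  qed
  ultimately show ?thesis by (simp add: qreal_commute)
qed

lemma hermitian_sum_closed_paths:
  assumes "a \<in> S" "hermitian_on S f"
  shows "(\<Sum>u \<in> dist_lists (S - {a}). qreal (w (length u) (set u)) * path_prod f (a # u @ [a]))
    = qreal (\<Sum>u \<in> dist_lists (S - {a}). w (length u) (set u) * qre (path_prod f (a # u @ [a])))"
proof -
  let ?X = "\<Sum>u \<in> dist_lists (S - {a}). qreal (w (length u) (set u)) * path_prod f (a # u @ [a])"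
  have "qcnj ?X = ?X"
    by (rule qcnj_sum_closed_paths[OF assms(1)]) (rule hermitian_onD[OF assms(2)])
  then show ?thesis by (simp add: qcnj_fixed_iff del: qcnj_sum)
qed

text \<open>Here the real parts of the expansion are dropped: for a Hermitian \<open>f\<close> the
  imaginary contributions of a closed path and its reverse cancel.\<close>

lemma herm_det_closed_paths:
  assumes "finite S" "a \<in> S" "hermitian_on S f"
  shows "(\<Sum>u \<in> dist_lists (S - {a}). qreal ((-1) ^ length u * herm_det f (S - set (a # u))) * path_prod f (a # u @ [a]))
    = qreal (herm_det f S)"
  using hermitian_sum_closed_paths[OF assms(2,3), of "\<lambda>k U. (-1) ^ k * herm_det f (S - insert a U)"]
  by (simp add: herm_det_expand[OF assms(1,2)])

lemma signed_qreal:
  "(-1) ^ k * (qreal x * p) = qreal ((-1) ^ k * x) * p"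
  "(-1) ^ k * (p * qreal x) = qreal ((-1) ^ k * x) * p"
  unfolding qreal_simps qreal_power_minus_1 by (simp_all only: qreal_commute[of p x] mult.assoc)

text \<open>Induction on the size: once the cycle through the minimum is split off, the remaining
  determinant is real and may be pulled out on either side, so both orders give the same sum over
  closed paths.\<close>

lemma asc_desc_det_hermitian:
  assumes "finite S" "hermitian_on S f"
  shows "desc_det f S = qreal (herm_det f S)" "asc_det f S = qreal (herm_det f S)"
proof -
  have "desc_det f S = qreal (herm_det f S) \<and> asc_det f S = qreal (herm_det f S)"
    using assms
  proof (induction "card S" arbitrary: S rule: less_induct)
    case less
    show ?case
    proof (cases "S = {}")
      case True
      then show ?thesis
        by (simp add: desc_det_def asc_det_def cycle_leaders_def qreal_simps)
    next
      case False
      have Min: "Min S \<in> S" using False less by simp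
      have IH: "desc_det f (S - set (Min S # u)) = qreal (herm_det f (S - set (Min S # u)))"
        "asc_det f (S - set (Min S # u)) = qreal (herm_det f (S - set (Min S # u)))" for u
      proof -
        have "card (S - set (Min S # u)) < card S"
          using less Min by (intro psubset_card_mono) auto
        moreover have "hermitian_on (S - set (Min S # u)) f"
          using less by (blast intro: hermitian_on_mono)
        ultimately show "desc_det f (S - set (Min S # u)) = qreal (herm_det f (S - set (Min S # u)))"
            "asc_det f (S - set (Min S # u)) = qreal (herm_det f (S - set (Min S # u)))"
          using less by blast+
      qed
      show ?thesis
        using herm_det_closed_paths[OF less(2) Min less(3)]
        unfolding desc_det_expand[OF less(2) False] asc_det_expand[OF less(2) False] IH signed_qreal by simp
    qed
  qed
  then show "desc_det f S = qreal (herm_det f S)" "asc_det f S = qreal (herm_det f S)" by auto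
qed

lemma hdet_hermitian:
  assumes "hermitian_on {..<dim_row F} (\<lambda>i j. F $$ (i, j))"
  shows "hdet F = qreal (herm_det (\<lambda>i j. F $$ (i, j)) {..<dim_row F})"
proof (cases "dim_row F = 0")
  case True
  then show ?thesis by (simp add: hdet_def qreal_simps)
next
  case False
  let ?S = "{..<dim_row F}"
  have S: "finite ?S" "?S \<noteq> {}" using False by auto
  \<comment> \<open>Index 0 is the minimum, so the cycle that \<open>rdet 0\<close> puts first is
    also first in increasing order of leaders.\<close>
  moreover have "Min ?S = 0" using False by (intro Min_eqI) auto
  ultimately have "rdet 0 F = asc_det (\<lambda>i j. F $$ (i, j)) ?S"
    using asc_det_expand[OF S, of "\<lambda>i j. F $$ (i, j)"] rdet_expand[of 0 F] False by simp
  then show ?thesis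
    using False asc_desc_det_hermitian(2)[OF S(1) assms] by (simp add: hdet_def)
qed

section \<open>Invariance under renaming of indices\<close>

lemma sum_dist_lists_reindex:
  assumes "inj_on h S" "a \<in> S"
  shows "(\<Sum>u \<in> dist_lists (h ` S - {h a}). g u) = (\<Sum>u \<in> dist_lists (S - {a}). g (map h u))"
proof -
  have "dist_lists (h ` S - {h a}) = map h ` dist_lists (S - {a})"
  proof (intro equalityI subsetI)
    fix v assume v: "v \<in> dist_lists (h ` S - {h a})"
    define u where "u = map (inv_into S h) v"
    have "set v \<subseteq> h ` S" using v by (auto simp: dist_lists_def)
    then have "map h u = v" unfolding u_def by (auto simp: f_inv_into_f intro!: map_idI)
    moreover have "u \<in> dist_lists (S - {a})"
      using v \<open>set v \<subseteq> h ` S\<close> \<open>map h u = v\<close> unfolding dist_lists_def mem_Collect_eq u_def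
      by (auto simp: distinct_map inj_on_inv_into f_inv_into_f inv_into_into assms)
    ultimately show "v \<in> map h ` dist_lists (S - {a})" by blast
  next
    fix v assume "v \<in> map h ` dist_lists (S - {a})"
    then obtain u where u: "v = map h u" "distinct u" "set u \<subseteq> S - {a}" by (auto simp: dist_lists_def)
    have "inj_on h (set u)" using u(3) assms(1) by (auto intro: inj_on_subset)
    moreover have "h x \<noteq> h a" if "x \<in> set u" for x
      using that u(3) assms by (auto dest: inj_onD)
    ultimately show "v \<in> dist_lists (h ` S - {h a})"
      using u by (auto simp: dist_lists_def distinct_map)
  qed
  moreover have "inj_on (map h) (dist_lists (S - {a}))"
  proof (rule inj_onI)
    fix x y assume "x \<in> dist_lists (S - {a})" "y \<in> dist_lists (S - {a})" "map h x = map h y"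
    then show "x = y"
      by (intro map_inj_on[of h x y]) (auto simp: dist_lists_def intro: inj_on_subset[OF assms(1)])
  qed
  ultimately show ?thesis by (simp add: sum.reindex)
qed

text \<open>An expansion at an arbitrary index does not see the order on indices, so the induction
  works for every injective \<open>h\<close>, although leaders are defined as minima.\<close>

lemma herm_det_reindex:
  assumes "finite S" "inj_on h S" "\<And>i j. i \<in> S \<Longrightarrow> j \<in> S \<Longrightarrow> f i j = g (h i) (h j)"
  shows "herm_det f S = herm_det g (h ` S)"
  using assms
proof (induction "card S" arbitrary: S rule: less_induct)
  case less
  show ?case
  proof (cases "S = {}")
    case False
    then obtain a where a: "a \<in> S" by blast
    have "herm_det g (h ` S) = (\<Sum>u \<in> dist_lists (S - {a}).
        (-1) ^ length u * herm_det g (h ` S - set (h a # map h u)) * qre (path_prod g (h a # map h u @ [h a])))"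
      using less a by (simp add: herm_det_expand[of _ "h a"] sum_dist_lists_reindex)
    also have "\<dots> = herm_det f S"
      unfolding herm_det_expand[OF less(2) a]
    proof (intro sum.cong refl arg_cong2[where f = "(*)"])
      fix u assume u: "u \<in> dist_lists (S - {a})"
      have "set (a # u) \<subseteq> S" using u a by (auto simp: dist_lists_def)
      then have "h ` S - set (h a # map h u) = h ` (S - set (a # u))"
        using inj_on_image_set_diff[OF less(3), of S "set (a # u)"] by auto
      moreover have "herm_det f (S - set (a # u)) = herm_det g (h ` (S - set (a # u)))"
        using less(2) a by (intro less(1) psubset_card_mono less(4)) (auto intro: inj_on_subset[OF less(3)])
      ultimately show "herm_det g (h ` S - set (h a # map h u)) = herm_det f (S - set (a # u))"
        by simp
      have "path_prod g (map h (a # u @ [a])) = path_prod f (a # u @ [a])"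
        unfolding path_prod_map using \<open>set (a # u) \<subseteq> S\<close> a
        by (intro path_prod_cong less(4)[symmetric]) (auto dest: list.set_sel(2)[rotated])
      then show "qre (path_prod g (h a # map h u @ [h a])) = qre (path_prod f (a # u @ [a]))"
        by simp
    qed
    finally show ?thesis by simp
  qed simp
qed

lemma herm_det_cong:
  "finite S \<Longrightarrow> (\<And>i j. i \<in> S \<Longrightarrow> j \<in> S \<Longrightarrow> f i j = g i j) \<Longrightarrow> herm_det f S = herm_det g S"
  using herm_det_reindex[of S id f g] by simp

text \<open>The column determinant at \<open>a\<close> of a matrix that is Hermitian outside of row and column \<open>a\<close>.\<close>
definition cdet_on :: "(nat \<Rightarrow> nat \<Rightarrow> quat) \<Rightarrow> nat set \<Rightarrow> nat \<Rightarrow> quat" where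
  "cdet_on f S a = (\<Sum>u \<in> dist_lists (S - {a}).
     qreal ((-1) ^ length u * herm_det f (S - set (a # u))) * path_prod f (a # u @ [a]))"

text \<open>The cycles other than the one through \<open>i\<close> avoid row and column
  \<open>i\<close>, so together they give a real value. It commutes with the closed path through
  \<open>i\<close>, hence left and right placement agree.\<close>

lemma cdet_rdet_hermitian:
  assumes i: "i < dim_row F" and herm: "hermitian_on ({..<dim_row F} - {i}) (\<lambda>i j. F $$ (i, j))"
  shows "cdet i F = cdet_on (\<lambda>i j. F $$ (i, j)) {..<dim_row F} i"
    and "rdet i F = cdet_on (\<lambda>i j. F $$ (i, j)) {..<dim_row F} i"
proof -
  let ?f = "\<lambda>i j. F $$ (i, j)"
  have "hermitian_on ({..<dim_row F} - set (i # u)) ?f" for u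
    using herm by (rule hermitian_on_mono) auto
  then have eq: "desc_det ?f ({..<dim_row F} - set (i # u)) = qreal (herm_det ?f ({..<dim_row F} - set (i # u)))"
    "asc_det ?f ({..<dim_row F} - set (i # u)) = qreal (herm_det ?f ({..<dim_row F} - set (i # u)))" for u
    using asc_desc_det_hermitian[of "{..<dim_row F} - set (i # u)" ?f] by auto
  show "cdet i F = cdet_on ?f {..<dim_row F} i" "rdet i F = cdet_on ?f {..<dim_row F} i"
    unfolding cdet_expand[OF i] rdet_expand[OF i] cdet_on_def eq signed_qreal by simp_all
qed

lemma cdet_on_reindex:
  assumes "finite S" "inj_on h S" "\<And>i j. i \<in> S \<Longrightarrow> j \<in> S \<Longrightarrow> f i j = g (h i) (h j)" "a \<in> S"
  shows "cdet_on f S a = cdet_on g (h ` S) (h a)"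
  unfolding cdet_on_def sum_dist_lists_reindex[OF assms(2,4)]
proof (intro sum.cong refl arg_cong2[where f = "(*)"] arg_cong[where f = qreal])
  fix u assume u: "u \<in> dist_lists (S - {a})"
  show "(-1) ^ length u = (-1 :: real) ^ length (map h u)" by simp
  have "set (a # u) \<subseteq> S" using u assms by (auto simp: dist_lists_def)
  then have "h ` S - set (h a # map h u) = h ` (S - set (a # u))"
    using inj_on_image_set_diff[OF assms(2), of S "set (a # u)"] by auto
  moreover have "herm_det f (S - set (a # u)) = herm_det g (h ` (S - set (a # u)))"
    using assms by (intro herm_det_reindex) (auto intro: inj_on_subset[OF assms(2)])
  ultimately show "herm_det f (S - set (a # u)) = herm_det g (h ` S - set (h a # map h u))"
    by simp
  have "path_prod g (map h (a # u @ [a])) = path_prod f (a # u @ [a])"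
    unfolding path_prod_map using \<open>set (a # u) \<subseteq> S\<close> assms(4)
    by (intro path_prod_cong assms(3)[symmetric]) (auto dest: list.set_sel(2)[rotated])
  then show "path_prod f (a # u @ [a]) = path_prod g (h a # map h u @ [h a])"
    by simp
qed

section \<open>Principal submatrices as index sets\<close>

lemma pick_bij_betw:
  assumes "finite \<beta>"
  shows "bij_betw (pick \<beta>) {..<card \<beta>} \<beta>"
proof (rule bij_betwI')
  fix x y assume "x \<in> {..<card \<beta>}" "y \<in> {..<card \<beta>}"
  then show "(pick \<beta> x = pick \<beta> y) = (x = y)"
    by (metis lessThan_iff linorder_neqE_nat nat_less_le pick_mono_le)
next
  fix x assume "x \<in> {..<card \<beta>}"
  then show "pick \<beta> x \<in> \<beta>" by (simp add: pick_in_set_le)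
next
  fix y assume y: "y \<in> \<beta>"
  then have "card {a \<in> \<beta>. a < y} < card \<beta>"
    using assms by (intro psubset_card_mono) auto
  then show "\<exists>x\<in>{..<card \<beta>}. y = pick \<beta> x"
    using pick_card_in_set[OF y] by (metis lessThan_iff)
qed

context
  fixes G :: "quat mat" and n :: nat and \<beta> :: "nat set"
  assumes G: "G \<in> carrier_mat n n" and \<beta>: "\<beta> \<subseteq> {..<n}"
begin

private lemma finb: "finite \<beta>"
  using \<beta> finite_subset by blast

private lemma bij: "inj_on (pick \<beta>) {..<card \<beta>}" "pick \<beta> ` {..<card \<beta>} = \<beta>"
  using pick_bij_betw[OF finb] by (auto simp: bij_betw_def)

private lemma sub_set_eq: "{i. i < dim_row G \<and> i \<in> \<beta>} = \<beta>" "{i. i < dim_col G \<and> i \<in> \<beta>} = \<beta>"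
  using G \<beta> by auto

private lemma dim_sub: "dim_row (submatrix G \<beta> \<beta>) = card \<beta>"
  by (simp only: dim_submatrix sub_set_eq)

private lemma index_sub:
  "i < card \<beta> \<Longrightarrow> j < card \<beta> \<Longrightarrow> submatrix G \<beta> \<beta> $$ (i, j) = G $$ (pick \<beta> i, pick \<beta> j)"
  by (rule submatrix_index) (simp_all only: sub_set_eq)

lemma hdet_minor_hermitian:
  assumes "hermitian_on \<beta> (\<lambda>i j. G $$ (i, j))"
  shows "hdet_minor G \<beta> = qreal (herm_det (\<lambda>i j. G $$ (i, j)) \<beta>)"
proof -
  have "hermitian_on {..<card \<beta>} (\<lambda>i j. submatrix G \<beta> \<beta> $$ (i, j))"
    by (rule hermitian_onI) (simp add: index_sub pick_in_set_le hermitian_onD[OF assms, symmetric])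
  then show ?thesis
    using herm_det_reindex[OF _ bij(1), of "\<lambda>i j. submatrix G \<beta> \<beta> $$ (i, j)" "\<lambda>i j. G $$ (i, j)"]
    by (simp add: hdet_minor_def hdet_hermitian dim_sub index_sub bij(2))
qed

lemma cdet_rdet_minor_hermitian:
  assumes g: "g \<in> \<beta>" and herm: "hermitian_on (\<beta> - {g}) (\<lambda>i j. G $$ (i, j))"
  shows "cdet_minor g G \<beta> = cdet_on (\<lambda>i j. G $$ (i, j)) \<beta> g"
    and "rdet_minor g G \<beta> = cdet_on (\<lambda>i j. G $$ (i, j)) \<beta> g"
proof -
  define k where "k = card {a \<in> \<beta>. a < g}"
  have "card {a \<in> \<beta>. a < g} < card \<beta>"
    by (rule psubset_card_mono[OF finb]) (use g in auto)
  then have k: "k < card \<beta>" "pick \<beta> k = g"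
    using pick_card_in_set[OF g] by (simp_all only: k_def)
  have "pick \<beta> i \<noteq> g" if "i < card \<beta>" "i \<noteq> k" for i
    using inj_on_eq_iff[OF bij(1), of i k] that k by simp
  then have herm': "hermitian_on ({..<card \<beta>} - {k}) (\<lambda>i j. submatrix G \<beta> \<beta> $$ (i, j))"
    by (intro hermitian_onI) (simp add: index_sub pick_in_set_le hermitian_onD[OF herm, symmetric])
  have "cdet_on (\<lambda>i j. submatrix G \<beta> \<beta> $$ (i, j)) {..<card \<beta>} k = cdet_on (\<lambda>i j. G $$ (i, j)) \<beta> g"
    using cdet_on_reindex[OF _ bij(1), of "\<lambda>i j. submatrix G \<beta> \<beta> $$ (i, j)" "\<lambda>i j. G $$ (i, j)" k] k
    by (simp add: index_sub bij(2))
  then show "cdet_minor g G \<beta> = cdet_on (\<lambda>i j. G $$ (i, j)) \<beta> g"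
    and "rdet_minor g G \<beta> = cdet_on (\<lambda>i j. G $$ (i, j)) \<beta> g"
    using cdet_rdet_hermitian[of k "submatrix G \<beta> \<beta>"] herm' k
    by (simp_all add: cdet_minor_def rdet_minor_def dim_sub k_def)
qed

end

section \<open>Cramer's rule for sums of minors\<close>

lemma sum_dist_lists_Cons:
  assumes "finite T"
  shows "(\<Sum>u \<in> dist_lists T. g u) = g [] + (\<Sum>b \<in> T. \<Sum>v \<in> dist_lists (T - {b}). g (b # v))"
proof -
  let ?B = "SIGMA b:T. dist_lists (T - {b})"
  have dl: "dist_lists T = insert [] ((\<lambda>(b, v). b # v) ` ?B)"
  proof (intro equalityI subsetI)
    fix u assume "u \<in> dist_lists T"
    then show "u \<in> insert [] ((\<lambda>(b, v). b # v) ` ?B)"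
      by (cases u) (auto simp: dist_lists_def image_iff)
  qed (auto simp: dist_lists_def)
  have "(\<Sum>u \<in> dist_lists T. g u) = g [] + (\<Sum>u \<in> (\<lambda>(b, v). b # v) ` ?B. g u)"
    unfolding dl using assms by (subst sum.insert) auto
  also have "(\<Sum>u \<in> (\<lambda>(b, v). b # v) ` ?B. g u) = (\<Sum>x \<in> ?B. g (fst x # snd x))"
    by (subst sum.reindex) (auto simp: inj_on_def case_prod_unfold)
  also have "\<dots> = (\<Sum>b \<in> T. \<Sum>v \<in> dist_lists (T - {b}). g (b # v))"
    by (subst sum.Sigma) (use assms in \<open>auto simp: case_prod_unfold\<close>)
  finally show ?thesis .
qed

text \<open>Such a list contains \<open>a\<close> exactly once, so cutting there is reversible. The
  part \<open>v\<close> after \<open>a\<close> is the outer variable, so that the inner sum over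
  \<open>u\<close> ranges over closed paths avoiding \<open>v\<close>.\<close>

lemma sum_dist_lists_mem:
  assumes "finite S" "a \<in> S"
  shows "(\<Sum>w \<in> {w \<in> dist_lists S. a \<in> set w}. g w)
    = (\<Sum>v \<in> dist_lists (S - {a}). \<Sum>u \<in> dist_lists (S - set v - {a}). g (u @ a # v))"
proof -
  let ?B = "SIGMA v:dist_lists (S - {a}). dist_lists (S - set v - {a})"
  have "(\<Sum>w \<in> {w \<in> dist_lists S. a \<in> set w}. g w) = (\<Sum>x \<in> ?B. g (snd x @ a # fst x))"
  proof (rule sum.reindex_bij_witness[where i = "\<lambda>x. snd x @ a # fst x"
        and j = "\<lambda>w. (tl (dropWhile (\<lambda>x. x \<noteq> a) w), takeWhile (\<lambda>x. x \<noteq> a) w)"])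
    fix w assume w: "w \<in> {w \<in> dist_lists S. a \<in> set w}"
    then obtain u v where uv: "w = u @ a # v" "a \<notin> set u"
      using split_list_first[of a w] by auto
    have "takeWhile (\<lambda>x. x \<noteq> a) w = u" "dropWhile (\<lambda>x. x \<noteq> a) w = a # v"
      using uv by (auto simp: takeWhile_append dropWhile_append)
    then show "snd (tl (dropWhile (\<lambda>x. x \<noteq> a) w), takeWhile (\<lambda>x. x \<noteq> a) w) @
        a # fst (tl (dropWhile (\<lambda>x. x \<noteq> a) w), takeWhile (\<lambda>x. x \<noteq> a) w) = w"
      and "(tl (dropWhile (\<lambda>x. x \<noteq> a) w), takeWhile (\<lambda>x. x \<noteq> a) w) \<in> ?B"
      and "g (snd (tl (dropWhile (\<lambda>x. x \<noteq> a) w), takeWhile (\<lambda>x. x \<noteq> a) w) @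
        a # fst (tl (dropWhile (\<lambda>x. x \<noteq> a) w), takeWhile (\<lambda>x. x \<noteq> a) w)) = g w"
      using uv w by (auto simp: dist_lists_def)
  next
    fix x assume "x \<in> ?B"
    then have x: "a \<notin> set (snd x)" "snd x @ a # fst x \<in> {w \<in> dist_lists S. a \<in> set w}"
      using assms by (auto simp: dist_lists_def)
    have "takeWhile (\<lambda>y. y \<noteq> a) (snd x @ a # fst x) = snd x"
      "dropWhile (\<lambda>y. y \<noteq> a) (snd x @ a # fst x) = a # fst x"
      using x(1) by (auto simp: takeWhile_append dropWhile_append)
    then show "(tl (dropWhile (\<lambda>y. y \<noteq> a) (snd x @ a # fst x)), takeWhile (\<lambda>y. y \<noteq> a) (snd x @ a # fst x)) = x"
      by simp
    show "snd x @ a # fst x \<in> {w \<in> dist_lists S. a \<in> set w}" by (rule x(2))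
  qed
  also have "\<dots> = (\<Sum>v \<in> dist_lists (S - {a}). \<Sum>u \<in> dist_lists (S - set v - {a}). g (u @ a # v))"
    by (subst sum.Sigma) (use assms in \<open>auto simp: case_prod_unfold\<close>)
  finally show ?thesis .
qed

text \<open>The column determinant at \<open>a\<close> of a Hermitian \<open>f\<close> on \<open>S\<close> whose column \<open>a\<close> is replaced by \<open>c\<close>.\<close>
definition cramer :: "(nat \<Rightarrow> nat \<Rightarrow> quat) \<Rightarrow> (nat \<Rightarrow> quat) \<Rightarrow> nat set \<Rightarrow> nat \<Rightarrow> quat" where
  "cramer f c S a = (\<Sum>u \<in> dist_lists (S - {a}).
     qreal ((-1) ^ length u * herm_det f (S - set (a # u))) * (path_prod f (a # u) * c (last (a # u))))"

text \<open>Column \<open>a\<close> is used only by the closing step of the path, so the new column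
  supplies just the last factor; the complementary determinants avoid \<open>a\<close>.\<close>

lemma cdet_on_col_repl:
  assumes "finite S" "a \<in> S"
    and g: "\<And>i j. i \<in> S \<Longrightarrow> j \<in> S \<Longrightarrow> g i j = (if j = a then c i else f i j)"
  shows "cdet_on g S a = cramer f c S a"
  unfolding cdet_on_def cramer_def
proof (intro sum.cong refl arg_cong2[where f = "(*)"] arg_cong[where f = qreal])
  fix u assume u: "u \<in> dist_lists (S - {a})"
  show "herm_det g (S - set (a # u)) = herm_det f (S - set (a # u))"
    using assms(1) by (intro herm_det_cong) (auto simp: g)
  have sub: "set (a # u) \<subseteq> S" "a \<notin> set u" using u assms by (auto simp: dist_lists_def)
  have bl: "butlast (a # u) @ [last (a # u)] = a # u" by (rule append_butlast_last_id) simp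
  then have snoc: "a # u @ [a] = butlast (a # u) @ [last (a # u), a]"
    by (metis append.assoc append_Cons append_Nil)
  have "path_prod g (a # u @ [a]) = path_prod g (a # u) * g (last (a # u)) a"
    by (simp only: snoc path_prod_snoc bl)
  also have "path_prod g (a # u) = path_prod f (a # u)"
    using sub by (intro path_prod_cong) (auto simp: g subset_iff)
  also have "g (last (a # u)) a = c (last (a # u))"
    using last_in_set[of "a # u"] sub assms(2) by (subst g) auto
  finally show "path_prod g (a # u @ [a]) = path_prod f (a # u) * c (last (a # u))" .
qed

lemma cramer_own_column:
  assumes "finite S" "a \<in> S" "hermitian_on S f"
  shows "cramer f (\<lambda>i. f i a) S a = qreal (herm_det f S)"
  using cdet_on_col_repl[OF assms(1,2), of f "\<lambda>i. f i a" f] herm_det_closed_paths[OF assms]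
  by (simp add: cdet_on_def)

lemma qreal_left_commute: "a * (qreal x * b) = qreal x * (a * b)"
  by (metis mult.assoc qreal_commute)

lemma qreal_uminus: "qreal (- x) = - qreal x"
  by (simp add: qreal_simps)

text \<open>Paths are sorted by their second vertex: without one there remains the term with
  \<open>c a\<close>, and otherwise the rest is a path from \<open>b\<close> inside
  \<open>S - {a}\<close>, one step shorter and hence of opposite sign.\<close>

lemma cramer_first_step:
  assumes "finite S" "a \<in> S"
  shows "cramer f c S a = qreal (herm_det f (S - {a})) * c a - (\<Sum>b \<in> S - {a}. f a b * cramer f c (S - {a}) b)"
proof -
  have "qreal ((-1) ^ length (b # v) * herm_det f (S - set (a # b # v)))
        * (path_prod f (a # b # v) * c (last (a # b # v)))
      = - (f a b * (qreal ((-1) ^ length v * herm_det f (S - {a} - set (b # v)))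
        * (path_prod f (b # v) * c (last (b # v)))))" for b v
  proof -
    have "S - set (a # b # v) = S - {a} - set (b # v)" by auto
    then show ?thesis
      by (simp add: qreal_uminus qreal_left_commute mult.assoc)
  qed
  then show ?thesis
    unfolding cramer_def[of f c S] cramer_def[of f c "S - {a}"]
    using assms by (subst sum_dist_lists_Cons) (simp_all add: sum_distrib_left sum_negf)
qed

text \<open>Expanding the left-hand side gives a signed sum over walks that start at \<open>a\<close> and continue
  along a list of distinct indices. Cutting a walk that returns to \<open>a\<close> at its return point and
  summing over the closed part shows that these walks cancel the ones that do not return.\<close>
lemma cramer_solves:
  assumes S: "finite S" "a \<in> S" and herm: "hermitian_on S f"
  shows "(\<Sum>b \<in> S. f a b * cramer f c S b) = qreal (herm_det f S) * c a"
proof -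
  define G where "G w = qreal ((-1) ^ length w * herm_det f (S - set w)) * (path_prod f (a # w) * c (last (a # w)))" for w
  have "f a b * (qreal ((-1) ^ length u * herm_det f (S - set (b # u))) * (path_prod f (b # u) * c (last (b # u))))
      = - G (b # u)" for b u
    unfolding G_def by (simp add: qreal_uminus qreal_left_commute mult.assoc)
  then have lhs: "(\<Sum>b \<in> S. f a b * cramer f c S b) = - (\<Sum>b \<in> S. \<Sum>u \<in> dist_lists (S - {b}). G (b # u))"
    unfolding cramer_def by (simp add: sum_distrib_left sum_negf)
  have ret: "(\<Sum>w \<in> {w \<in> dist_lists S. a \<in> set w}. G w) = - (\<Sum>v \<in> dist_lists (S - {a}). G v)"
  proof -
    \<comment> \<open>With the open tail \<open>v\<close> fixed, the closed parts through
      \<open>a\<close> add up to the real determinant on \<open>S - set v\<close>, which is the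
      weight in \<open>G v\<close>; the additional vertex \<open>a\<close> reverses the
      sign.\<close>
    have "(\<Sum>u \<in> dist_lists (S - set v - {a}). G (u @ a # v)) = - G v"
      if v: "v \<in> dist_lists (S - {a})" for v
    proof -
      let ?T = "S - set v"
      have T: "finite ?T" "a \<in> ?T" "hermitian_on ?T f"
        using S v herm by (auto simp: dist_lists_def intro: hermitian_on_mono)
      let ?q = "path_prod f (a # v) * c (last (a # v))"
      have "G (u @ a # v) = - (qreal ((-1) ^ length v) *
          (qreal ((-1) ^ length u * herm_det f (?T - set (a # u))) * path_prod f (a # u @ [a]) * ?q))" for u
      proof -
        have "S - set (u @ a # v) = ?T - set (a # u)" by auto
        moreover have "path_prod f (a # u @ a # v) = path_prod f (a # u @ [a]) * path_prod f (a # v)"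
          using path_prod_append[of f "a # u" a v] by simp
        moreover have "last (a # u @ a # v) = last (a # v)" by simp
        moreover have "qreal ((-1) ^ length (u @ a # v) * x)
            = - (qreal ((-1) ^ length v) * qreal ((-1) ^ length u * x))" for x
          unfolding qreal_simps(6)[symmetric] qreal_uminus[symmetric]
          by (simp add: power_add mult_ac)
        ultimately show ?thesis
          unfolding G_def by (simp only: append_Cons mult.assoc mult_minus_left)
      qed
      then have "(\<Sum>u \<in> dist_lists (?T - {a}). G (u @ a # v)) = - (qreal ((-1) ^ length v) *
          ((\<Sum>u \<in> dist_lists (?T - {a}). qreal ((-1) ^ length u * herm_det f (?T - set (a # u))) * path_prod f (a # u @ [a])) * ?q))"
        by (simp add: sum_negf sum_distrib_left sum_distrib_right)
      also have "\<dots> = - G v"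
        unfolding herm_det_closed_paths[OF T] G_def by (simp add: qreal_simps mult.assoc)
      finally show ?thesis .
    qed
    then show ?thesis
      unfolding sum_dist_lists_mem[OF S] by (simp add: sum_negf)
  qed
  have "dist_lists S = {w \<in> dist_lists S. a \<in> set w} \<union> dist_lists (S - {a})"
    by (auto simp: dist_lists_def)
  moreover have "(\<Sum>w \<in> {w \<in> dist_lists S. a \<in> set w} \<union> dist_lists (S - {a}). G w)
      = (\<Sum>w \<in> {w \<in> dist_lists S. a \<in> set w}. G w) + (\<Sum>w \<in> dist_lists (S - {a}). G w)"
    by (rule sum.union_disjoint) (use S in \<open>simp, simp, auto simp: dist_lists_def\<close>)
  ultimately have "(\<Sum>w \<in> dist_lists S. G w) = 0"
    using ret by simp
  \<comment> \<open>The empty walk carries the right-hand side: the full determinant times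
    \<open>c a\<close>.\<close>
  then have "G [] = - (\<Sum>b \<in> S. \<Sum>u \<in> dist_lists (S - {b}). G (b # u))"
    unfolding sum_dist_lists_Cons[OF S(1)] by (simp add: add_eq_0_iff2)
  then show ?thesis
    unfolding lhs by (simp add: G_def)
qed

section \<open>Sums over all index sets of one size\<close>

definition minor_sum :: "(nat \<Rightarrow> nat \<Rightarrow> quat) \<Rightarrow> nat \<Rightarrow> nat \<Rightarrow> real" where
  "minor_sum f n k = (\<Sum>\<beta> \<in> Lkn k n. herm_det f \<beta>)"

definition cramer_sum :: "(nat \<Rightarrow> nat \<Rightarrow> quat) \<Rightarrow> (nat \<Rightarrow> quat) \<Rightarrow> nat \<Rightarrow> nat \<Rightarrow> nat \<Rightarrow> quat" where
  "cramer_sum f c n k g = (\<Sum>\<beta> \<in> Lkn_with k n g. cramer f c \<beta> g)"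

lemma finite_Lkn [simp]: "finite (Lkn k n)"
  unfolding Lkn_def by (rule finite_subset[of _ "Pow {..<n}"]) auto

lemma finite_mem_Lkn: "\<beta> \<in> Lkn k n \<Longrightarrow> finite \<beta>"
  unfolding Lkn_def using finite_subset by blast

lemma Lkn_0 [simp]: "Lkn 0 n = {{}}"
  by (auto simp: Lkn_def dest: finite_subset[OF _ finite_lessThan])

lemma Lkn_gt:
  assumes "n < k"
  shows "Lkn k n = {}"
proof (rule ccontr)
  assume "Lkn k n \<noteq> {}"
  then obtain \<beta> where "\<beta> \<subseteq> {..<n}" "card \<beta> = k" by (auto simp: Lkn_def)
  then show False using card_mono[OF finite_lessThan, of \<beta> n] assms by simp
qed

lemma sum_Lkn_with:
  "(\<Sum>b<n. \<Sum>\<beta> \<in> Lkn_with k n b. F b \<beta>) = (\<Sum>\<beta> \<in> Lkn k n. \<Sum>b \<in> \<beta>. F b \<beta>)"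
proof -
  have "(\<Sum>b<n. \<Sum>\<beta> \<in> Lkn_with k n b. F b \<beta>) = (\<Sum>\<beta> \<in> Lkn k n. \<Sum>b \<in> {b \<in> {..<n}. b \<in> \<beta>}. F b \<beta>)"
    unfolding Lkn_with_def by (rule sum.swap_restrict) auto
  also have "\<dots> = (\<Sum>\<beta> \<in> Lkn k n. \<Sum>b \<in> \<beta>. F b \<beta>)"
    by (intro sum.cong) (auto simp: Lkn_def)
  finally show ?thesis .
qed

lemma sum_Lkn_with_Suc:
  assumes "a < n"
  shows "(\<Sum>\<beta> \<in> Lkn_with (Suc k) n a. F \<beta>) = (\<Sum>\<gamma> \<in> {\<gamma> \<in> Lkn k n. a \<notin> \<gamma>}. F (insert a \<gamma>))"
proof (rule sum.reindex_bij_witness[where i = "insert a" and j = "\<lambda>\<beta>. \<beta> - {a}"])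
  fix \<beta> assume "\<beta> \<in> Lkn_with (Suc k) n a"
  then have b: "a \<in> \<beta>" "\<beta> \<subseteq> {..<n}" "card \<beta> = Suc k" by (auto simp: Lkn_with_def Lkn_def)
  then show "insert a (\<beta> - {a}) = \<beta>" "F (insert a (\<beta> - {a})) = F \<beta>" by (simp_all add: insert_absorb)
  show "\<beta> - {a} \<in> {\<gamma> \<in> Lkn k n. a \<notin> \<gamma>}"
    using b by (auto simp: Lkn_def)
next
  fix \<gamma> assume "\<gamma> \<in> {\<gamma> \<in> Lkn k n. a \<notin> \<gamma>}"
  then have g: "a \<notin> \<gamma>" "\<gamma> \<subseteq> {..<n}" "card \<gamma> = k" "finite \<gamma>"
    by (auto simp: Lkn_def intro: finite_subset)
  then show "insert a \<gamma> - {a} = \<gamma>" by simp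
  show "insert a \<gamma> \<in> Lkn_with (Suc k) n a"
    using g assms by (auto simp: Lkn_def Lkn_with_def)
qed

text \<open>Coefficient comparison in Cramer's rule for \<open>\<lambda>I + f\<close>.\<close>
lemma cramer_sum_Suc:
  assumes a: "a < n" and herm: "hermitian_on {..<n} f"
  shows "cramer_sum f c n (Suc k) a + (\<Sum>b<n. f a b * cramer_sum f c n k b) = qreal (minor_sum f n k) * c a"
proof -
  let ?E = "\<lambda>\<gamma>. \<Sum>b \<in> \<gamma>. f a b * cramer f c \<gamma> b"
  let ?out = "{\<gamma> \<in> Lkn k n. a \<notin> \<gamma>}" and ?in = "{\<gamma> \<in> Lkn k n. a \<in> \<gamma>}"
  have "cramer_sum f c n (Suc k) a = (\<Sum>\<gamma> \<in> ?out. qreal (herm_det f \<gamma>) * c a - ?E \<gamma>)"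
    unfolding cramer_sum_def sum_Lkn_with_Suc[OF a]
  proof (rule sum.cong[OF refl])
    fix \<gamma> assume g: "\<gamma> \<in> ?out"
    then have "insert a \<gamma> - {a} = \<gamma>" by simp
    then show "cramer f c (insert a \<gamma>) a = qreal (herm_det f \<gamma>) * c a - ?E \<gamma>"
      using cramer_first_step[of "insert a \<gamma>" a f c] g finite_mem_Lkn[of \<gamma> k n] by simp
  qed
  moreover have "(\<Sum>b<n. f a b * cramer_sum f c n k b) = (\<Sum>\<gamma> \<in> Lkn k n. ?E \<gamma>)"
    by (simp add: cramer_sum_def sum_distrib_left sum_Lkn_with)
  moreover have split: "(\<Sum>\<gamma> \<in> Lkn k n. F \<gamma>) = (\<Sum>\<gamma> \<in> ?out. F \<gamma>) + (\<Sum>\<gamma> \<in> ?in. F \<gamma>)" for F :: "nat set \<Rightarrow> quat"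
  proof -
    have "Lkn k n = ?out \<union> ?in" by blast
    then show ?thesis
      using sum.union_disjoint[of ?out ?in F] by (auto simp: disjoint_iff)
  qed
  \<comment> \<open>Sets avoiding \<open>a\<close> are removed by the first-step terms of order
    \<open>Suc k\<close>; on a set containing \<open>a\<close> Cramer's rule applies as it
    stands.\<close>
  moreover have "(\<Sum>\<gamma> \<in> ?in. ?E \<gamma>) = (\<Sum>\<gamma> \<in> ?in. qreal (herm_det f \<gamma>) * c a)"
  proof (rule sum.cong[OF refl])
    fix \<gamma> assume g: "\<gamma> \<in> ?in"
    then have "\<gamma> \<subseteq> {..<n}" by (simp add: Lkn_def)
    then show "?E \<gamma> = qreal (herm_det f \<gamma>) * c a"
      using g by (intro cramer_solves hermitian_on_mono[OF herm]) (auto intro: finite_mem_Lkn)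
  qed
  moreover have "qreal (minor_sum f n k) * c a = (\<Sum>\<gamma> \<in> Lkn k n. qreal (herm_det f \<gamma>) * c a)"
    by (simp add: minor_sum_def qreal_sum sum_distrib_right)
  ultimately show ?thesis
    by (simp add: sum_subtractf)
qed

text \<open>Replacing a column by itself gives back the determinant, so each index set of size
  \<open>k\<close> is counted once for each of its \<open>k\<close> elements.\<close>

lemma cramer_sum_trace:
  assumes "hermitian_on {..<n} f"
  shows "(\<Sum>g<n. cramer_sum f (\<lambda>i. f i g) n k g) = qreal (real k * minor_sum f n k)"
proof -
  have "(\<Sum>g<n. cramer_sum f (\<lambda>i. f i g) n k g) = (\<Sum>\<beta> \<in> Lkn k n. \<Sum>g \<in> \<beta>. cramer f (\<lambda>i. f i g) \<beta> g)"
    unfolding cramer_sum_def sum_Lkn_with ..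
  also have "\<dots> = (\<Sum>\<beta> \<in> Lkn k n. qreal (real k * herm_det f \<beta>))"
  proof (rule sum.cong[OF refl])
    fix \<beta> assume b: "\<beta> \<in> Lkn k n"
    then have "\<beta> \<subseteq> {..<n}" by (simp add: Lkn_def)
    then have "hermitian_on \<beta> f" by (rule hermitian_on_mono[OF assms])
    then have "(\<Sum>g \<in> \<beta>. cramer f (\<lambda>i. f i g) \<beta> g) = (\<Sum>g \<in> \<beta>. qreal (herm_det f \<beta>))"
      using cramer_own_column finite_mem_Lkn[OF b] by (intro sum.cong) auto
    also have "\<dots> = qreal (\<Sum>g \<in> \<beta>. herm_det f \<beta>)" by (simp only: qreal_sum)
    also have "(\<Sum>g \<in> \<beta>. herm_det f \<beta>) = real k * herm_det f \<beta>" using b by (simp add: Lkn_def)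
    finally show "(\<Sum>g \<in> \<beta>. cramer f (\<lambda>i. f i g) \<beta> g) = qreal (real k * herm_det f \<beta>)" .
  qed
  also have "\<dots> = qreal (real k * minor_sum f n k)"
    by (simp add: minor_sum_def sum_distrib_left qreal_sum)
  finally show ?thesis .
qed

section \<open>The Faddeev--LeVerrier matrices\<close>

abbreviation entries :: "quat mat \<Rightarrow> nat \<Rightarrow> nat \<Rightarrow> quat" where
  "entries A \<equiv> \<lambda>i j. A $$ (i, j)"

section \<open>Matrix products, conjugate transposes and Gram matrices\<close>

lemma index_mult_mat_sum:
  assumes "A \<in> carrier_mat n m" "B \<in> carrier_mat m k" "i < n" "j < k"
  shows "(A * B) $$ (i, j) = (\<Sum>l<m. A $$ (i, l) * B $$ (l, j))"
  using assms by (auto simp: scalar_prod_def atLeast0LessThan intro!: sum.cong)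

lemma ctrans_index [simp]: "i < dim_col A \<Longrightarrow> j < dim_row A \<Longrightarrow> ctrans A $$ (i, j) = qcnj (A $$ (j, i))"
  by (simp add: ctrans_def)

lemma ctrans_dim [simp]: "dim_row (ctrans A) = dim_col A" "dim_col (ctrans A) = dim_row A"
  by (simp_all add: ctrans_def)

lemma ctrans_carrier [simp, intro]: "A \<in> carrier_mat n m \<Longrightarrow> ctrans A \<in> carrier_mat m n"
  by (rule carrier_matI) simp_all

lemma ctrans_ctrans [simp]: "ctrans (ctrans A) = A"
  by (rule eq_matI) auto

lemma ctrans_one [simp]: "ctrans (1\<^sub>m n) = 1\<^sub>m n"
  by (rule eq_matI) auto

lemma ctrans_zero [simp]: "ctrans (0\<^sub>m n m) = 0\<^sub>m m n"
  by (rule eq_matI) auto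

lemma ctrans_minus:
  "A \<in> carrier_mat n m \<Longrightarrow> B \<in> carrier_mat n m \<Longrightarrow> ctrans (A - B) = ctrans A - ctrans B"
  by (rule eq_matI) auto

lemma ctrans_smult [simp]: "ctrans (qreal x \<cdot>\<^sub>m A) = qreal x \<cdot>\<^sub>m ctrans A"
  by (rule eq_matI) (auto simp: qreal_commute)

lemma ctrans_mult:
  assumes "A \<in> carrier_mat n m" "B \<in> carrier_mat m k"
  shows "ctrans (A * B) = ctrans B * ctrans A"
proof (rule eq_matI)
  fix i j assume "i < dim_row (ctrans B * ctrans A)" "j < dim_col (ctrans B * ctrans A)"
  then have ij: "i < k" "j < n" using assms by auto
  then have "ctrans (A * B) $$ (i, j) = qcnj ((A * B) $$ (j, i))"
    using assms by simp
  also have "\<dots> = (\<Sum>l<m. qcnj (B $$ (l, i)) * qcnj (A $$ (j, l)))"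
    by (simp only: index_mult_mat_sum[OF assms ij(2,1)] qcnj_sum qcnj_mult)
  also have "\<dots> = (ctrans B * ctrans A) $$ (i, j)"
    using assms ij
    by (simp add: index_mult_mat_sum[OF ctrans_carrier[OF assms(2)] ctrans_carrier[OF assms(1)] ij] del: index_mult_mat)
  finally show "ctrans (A * B) $$ (i, j) = (ctrans B * ctrans A) $$ (i, j)" .
qed (use assms in auto)

lemma smult_qreal_mult_left:
  assumes "A \<in> carrier_mat n m" "B \<in> carrier_mat m k"
  shows "(qreal x \<cdot>\<^sub>m A) * B = qreal x \<cdot>\<^sub>m (A * B)"
proof (rule eq_matI)
  fix i j assume "i < dim_row (qreal x \<cdot>\<^sub>m (A * B))" "j < dim_col (qreal x \<cdot>\<^sub>m (A * B))"
  then have ij: "i < n" "j < k" using assms by auto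
  have "((qreal x \<cdot>\<^sub>m A) * B) $$ (i, j) = (\<Sum>l<m. (qreal x * A $$ (i, l)) * B $$ (l, j))"
    using assms ij by (subst index_mult_mat_sum[of _ n m _ k]) auto
  also have "\<dots> = qreal x * (A * B) $$ (i, j)"
    by (simp only: index_mult_mat_sum[OF assms ij] sum_distrib_left mult.assoc)
  finally show "((qreal x \<cdot>\<^sub>m A) * B) $$ (i, j) = (qreal x \<cdot>\<^sub>m (A * B)) $$ (i, j)"
    using assms ij by simp
qed (use assms in auto)

lemma smult_qreal_mult_right:
  assumes "A \<in> carrier_mat n m" "B \<in> carrier_mat m k"
  shows "A * (qreal x \<cdot>\<^sub>m B) = qreal x \<cdot>\<^sub>m (A * B)"
proof (rule eq_matI)
  fix i j assume "i < dim_row (qreal x \<cdot>\<^sub>m (A * B))" "j < dim_col (qreal x \<cdot>\<^sub>m (A * B))"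
  then have ij: "i < n" "j < k" using assms by auto
  have "(A * (qreal x \<cdot>\<^sub>m B)) $$ (i, j) = (\<Sum>l<m. A $$ (i, l) * (qreal x * B $$ (l, j)))"
    using assms ij by (subst index_mult_mat_sum[of _ n m _ k]) auto
  also have "\<dots> = qreal x * (A * B) $$ (i, j)"
    by (simp only: index_mult_mat_sum[OF assms ij] sum_distrib_left qreal_left_commute)
  finally show "(A * (qreal x \<cdot>\<^sub>m B)) $$ (i, j) = (qreal x \<cdot>\<^sub>m (A * B)) $$ (i, j)"
    using assms ij by simp
qed (use assms in auto)

lemma qre_qcnj_mult_self: "qre (qcnj a * a) = qnorm2 a"
  by (simp add: quat_arith_defs qnorm2_def power2_eq_square)

text \<open>The diagonal of the Gram matrix consists of sums of squared norms down the columns, so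
  no cancellation is possible there.\<close>

lemma gram_eq_0D:
  assumes M: "M \<in> carrier_mat n m" and 0: "ctrans M * M = 0\<^sub>m m m"
  shows "M = 0\<^sub>m n m"
proof (rule eq_matI)
  fix i j assume "i < dim_row (0\<^sub>m n m :: quat mat)" "j < dim_col (0\<^sub>m n m :: quat mat)"
  then have ij: "i < n" "j < m" by auto
  have "(ctrans M * M) $$ (j, j) = (\<Sum>l<n. qcnj (M $$ (l, j)) * M $$ (l, j))"
    using M ij by (subst index_mult_mat_sum[of _ m n _ m]) auto
  then have "(\<Sum>l<n. qnorm2 (M $$ (l, j))) = 0"
    using ij 0 by (simp add: qre_qcnj_mult_self[symmetric] flip: qre_sum)
  then have "qnorm2 (M $$ (i, j)) = 0"
    using ij by (subst (asm) sum_nonneg_eq_0_iff) (auto simp: qnorm2_def)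
  then show "M $$ (i, j) = 0\<^sub>m n m $$ (i, j)"
    using ij by (simp add: qnorm2_zero_iff zero_quat_def)
qed (use M in auto)

lemma gram_cancel_left:
  assumes A: "A \<in> carrier_mat m n" and Y: "Y \<in> carrier_mat n k"
    and 0: "ctrans A * A * Y = 0\<^sub>m n k"
  shows "A * Y = 0\<^sub>m m k"
proof (rule gram_eq_0D)
  show "A * Y \<in> carrier_mat m k" using A Y by simp
  have "ctrans (A * Y) * (A * Y) = ctrans Y * (ctrans A * A * Y)"
    using A Y by (simp add: ctrans_mult[OF A Y] assoc_mult_mat[of _ k n _ m _ k] assoc_mult_mat[of _ n m _ n _ k])
  also have "\<dots> = 0\<^sub>m k k" using Y by (simp add: 0)
  finally show "ctrans (A * Y) * (A * Y) = 0\<^sub>m k k" .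
qed

lemma mat_minus_eq_0D:
  assumes "A \<in> carrier_mat n m" "B \<in> carrier_mat n m" "A - B = 0\<^sub>m n m"
  shows "A = (B :: 'a :: ring mat)"
proof (rule eq_matI)
  fix i j assume ij: "i < dim_row B" "j < dim_col B"
  then have "(A - B) $$ (i, j) = 0" using assms by simp
  then show "A $$ (i, j) = B $$ (i, j)" using assms(1,2) ij by simp
qed (use assms in auto)

text \<open>The Faddeev--LeVerrier recursion; column \<open>j\<close> of \<open>herm_adj H k * Y\<close> collects the order-\<open>k\<close>
  principal minors of \<open>H\<close> with one column replaced by column \<open>j\<close> of \<open>Y\<close>.\<close>
fun herm_adj :: "quat mat \<Rightarrow> nat \<Rightarrow> quat mat" where
  "herm_adj H 0 = 0\<^sub>m (dim_row H) (dim_row H)"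
| "herm_adj H (Suc k) = qreal (minor_sum (entries H) (dim_row H) k) \<cdot>\<^sub>m 1\<^sub>m (dim_row H) - H * herm_adj H k"

declare herm_adj.simps(2) [simp del]

lemma minor_sum_0 [simp]: "minor_sum f n 0 = 1"
  by (simp add: minor_sum_def)

lemma minor_sum_gt: "n < k \<Longrightarrow> minor_sum f n k = 0"
  by (simp add: minor_sum_def Lkn_gt)

text \<open>The rank does not enter here; the value at 0 is 1, so the maximum is over a nonempty
  set. Equality with the rank is derived only after the Moore--Penrose inverse has been built from
  this index.\<close>

definition top_minor :: "(nat \<Rightarrow> nat \<Rightarrow> quat) \<Rightarrow> nat \<Rightarrow> nat" where
  "top_minor f n = Max {k. k \<le> n \<and> minor_sum f n k \<noteq> 0}"

lemma top_minor:
  shows "minor_sum f n (top_minor f n) \<noteq> 0" "top_minor f n \<le> n"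
    and "top_minor f n < k \<Longrightarrow> minor_sum f n k = 0"
proof -
  let ?K = "{k. k \<le> n \<and> minor_sum f n k \<noteq> 0}"
  have K: "finite ?K" "0 \<in> ?K" by auto
  then have "top_minor f n \<in> ?K" unfolding top_minor_def by (intro Max_in) auto
  then show "minor_sum f n (top_minor f n) \<noteq> 0" "top_minor f n \<le> n" by auto
  show "minor_sum f n k = 0" if "top_minor f n < k"
  proof (rule ccontr)
    assume nz: "minor_sum f n k \<noteq> 0"
    then have "k \<in> ?K" using minor_sum_gt[of n k f] by (auto simp: not_less[symmetric])
    then have "k \<le> top_minor f n" unfolding top_minor_def by (rule Max_ge[OF K(1)])
    then show False using that by simp
  qed
qed

text \<open>Conjugation turns a replaced row into a replaced column. The weights involve only
  indices other than \<open>a\<close>, where the Hermitian \<open>f\<close> and its conjugate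
  transpose \<open>g\<close> have the same entries.\<close>

lemma qcnj_cdet_on:
  assumes "finite S" "a \<in> S" "hermitian_on (S - {a}) f"
    and g: "\<And>i j. i \<in> S \<Longrightarrow> j \<in> S \<Longrightarrow> g i j = qcnj (f j i)"
  shows "qcnj (cdet_on f S a) = cdet_on g S a"
proof -
  have eq: "herm_det f (S - insert a U) = herm_det g (S - insert a U)" for U
  proof (rule herm_det_cong)
    fix i j assume "i \<in> S - insert a U" "j \<in> S - insert a U"
    then show "f i j = g i j"
      using hermitian_onD[OF assms(3), of i j] g[of i j] by simp
  qed (use assms(1) in simp)
  have "qcnj (\<Sum>u \<in> dist_lists (S - {a}). qreal ((-1) ^ length u * herm_det f (S - insert a (set u))) * path_prod f (a # u @ [a]))
    = (\<Sum>u \<in> dist_lists (S - {a}). qreal ((-1) ^ length u * herm_det f (S - insert a (set u))) * path_prod g (a # u @ [a]))"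
    by (rule qcnj_sum_closed_paths[OF assms(2), where w = "\<lambda>k U. (-1) ^ k * herm_det f (S - insert a U)"])
      (simp add: g)
  then show ?thesis
    unfolding cdet_on_def list.set eq .
qed

section \<open>The recursion for a Hermitian matrix\<close>

locale hermitian_mat =
  fixes H :: "quat mat" and n :: nat
  assumes H: "H \<in> carrier_mat n n" and herm: "ctrans H = H"
begin

abbreviation "L \<equiv> herm_adj H"
abbreviation "d \<equiv> minor_sum (entries H) n"
abbreviation "q \<equiv> top_minor (entries H) n"

lemma hermitian_entries: "hermitian_on {..<n} (entries H)"
proof (rule hermitian_onI)
  fix i j assume "i \<in> {..<n}" "j \<in> {..<n}"
  then have "ctrans H $$ (i, j) = qcnj (H $$ (j, i))" using H by simp
  then show "H $$ (i, j) = qcnj (H $$ (j, i))" by (simp add: herm)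
qed

lemma L_carrier [simp]: "L k \<in> carrier_mat n n"
  using H by (induction k) (auto simp: herm_adj.simps(2))

lemma L_dim [simp]: "dim_row (L k) = n" "dim_col (L k) = n"
  using carrier_matD[OF L_carrier] by auto

lemma L_Suc: "L (Suc k) = qreal (d k) \<cdot>\<^sub>m 1\<^sub>m n - H * L k"
  using H by (simp add: herm_adj.simps(2))

lemma L_commute: "L k * H = H * L k"
proof (induction k)
  case 0
  then show ?case using H by simp
next
  case (Suc k)
  have 1: "1\<^sub>m n \<in> carrier_mat n n" "H * L k \<in> carrier_mat n n" "qreal x \<cdot>\<^sub>m 1\<^sub>m n \<in> carrier_mat n n" for x
    using H by simp_all
  have "L (Suc k) * H = qreal (d k) \<cdot>\<^sub>m H - H * L k * H"
    unfolding L_Suc using H 1 by (simp add: minus_mult_distrib_mat[OF 1(3,2) H] smult_qreal_mult_left[OF 1(1) H])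
  also have "H * L k * H = H * (H * L k)"
    using H by (simp add: assoc_mult_mat[of _ n n _ n _ n] Suc)
  also have "qreal (d k) \<cdot>\<^sub>m H - H * (H * L k) = H * L (Suc k)"
    unfolding L_Suc using H 1 by (simp add: mult_minus_distrib_mat[OF H 1(3,2)] smult_qreal_mult_right[OF H 1(1)])
  finally show ?case .
qed

lemma L_hermitian: "ctrans (L k) = L k"
proof (induction k)
  case 0
  then show ?case by simp
next
  case (Suc k)
  have "ctrans (L (Suc k)) = qreal (d k) \<cdot>\<^sub>m 1\<^sub>m n - ctrans (H * L k)"
    unfolding L_Suc using H by (subst ctrans_minus[of _ n n]) simp_all
  also have "ctrans (H * L k) = H * L k"
    by (simp add: ctrans_mult[OF H L_carrier] herm Suc L_commute)
  finally show ?case using L_Suc by simp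
qed

text \<open>\<open>herm_adj\<close> is defined by the very recursion that
  \<open>cramer_sum_Suc\<close> imposes on the sums of minors, so both sides agree by induction on
  the order.\<close>

lemma L_mult_index:
  assumes Y: "Y \<in> carrier_mat n m" and ij: "i < n" "j < m"
  shows "(L k * Y) $$ (i, j) = cramer_sum (entries H) (\<lambda>l. Y $$ (l, j)) n k i"
  using ij(1)
proof (induction k arbitrary: i)
  case 0
  have "Lkn_with 0 n i = {}" by (auto simp: Lkn_with_def)
  then show ?case using 0 H Y ij by (simp add: cramer_sum_def)
next
  case (Suc k)
  have 1: "1\<^sub>m n \<in> carrier_mat n n" "H * L k \<in> carrier_mat n n" "qreal x \<cdot>\<^sub>m 1\<^sub>m n \<in> carrier_mat n n" for x
    using H by simp_all
  have "L (Suc k) * Y = qreal (d k) \<cdot>\<^sub>m Y - H * (L k * Y)"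
    unfolding L_Suc using H Y 1
    by (simp add: minus_mult_distrib_mat[OF 1(3,2) Y] smult_qreal_mult_left[OF 1(1) Y] assoc_mult_mat[of _ n n _ n _ m])
  then have "(L (Suc k) * Y) $$ (i, j) = qreal (d k) * Y $$ (i, j) - (H * (L k * Y)) $$ (i, j)"
    using Suc.prems ij(2) H Y by simp
  also have "(H * (L k * Y)) $$ (i, j) = (\<Sum>b<n. H $$ (i, b) * (L k * Y) $$ (b, j))"
    using Suc.prems ij(2) by (intro index_mult_mat_sum[OF H mult_carrier_mat[OF L_carrier Y]])
  also have "\<dots> = (\<Sum>b<n. H $$ (i, b) * cramer_sum (entries H) (\<lambda>l. Y $$ (l, j)) n k b)"
    by (intro sum.cong refl) (simp add: Suc.IH)
  also have "qreal (d k) * Y $$ (i, j) - (\<Sum>b<n. H $$ (i, b) * cramer_sum (entries H) (\<lambda>l. Y $$ (l, j)) n k b)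
      = cramer_sum (entries H) (\<lambda>l. Y $$ (l, j)) n (Suc k) i"
    unfolding diff_eq_eq by (rule cramer_sum_Suc[OF Suc.prems hermitian_entries, symmetric])
  finally show ?case .
qed

lemma L_mult_H_eq_0: 
  assumes "q < k" "k \<le> Suc n"
  shows "L k * H = 0\<^sub>m n n"
  using assms(2,1)
proof (induction k rule: inc_induct)
  case base
  show ?case
  proof (rule eq_matI)
    fix i j assume "i < dim_row (0\<^sub>m n n :: quat mat)" "j < dim_col (0\<^sub>m n n :: quat mat)"
    \<comment> \<open>There is no index set of size \<open>n + 1\<close>, which anchors the
      descent.\<close>
    moreover have "Lkn_with (Suc n) n i = {}" by (simp add: Lkn_with_def Lkn_gt)
    ultimately show "(L (Suc n) * H) $$ (i, j) = 0\<^sub>m n n $$ (i, j)"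
      using L_mult_index[OF H, of i j "Suc n"] by (simp add: cramer_sum_def)
  qed (use H in auto)
next
  case (step k)
  have 1: "1\<^sub>m n \<in> carrier_mat n n" "H * L k \<in> carrier_mat n n" "qreal x \<cdot>\<^sub>m 1\<^sub>m n \<in> carrier_mat n n"
      "L k * H \<in> carrier_mat n n" for x
    by (simp_all add: H mult_carrier_mat[of _ n n _ n])
  have "d k = 0" using step by (intro top_minor(3)) simp
  have "L (Suc k) * H = qreal (d k) \<cdot>\<^sub>m H - H * L k * H"
    unfolding L_Suc using H 1 by (simp add: minus_mult_distrib_mat[OF 1(3,2) H] smult_qreal_mult_left[OF 1(1) H])
  then have eq: "qreal (d k) \<cdot>\<^sub>m H - H * L k * H = 0\<^sub>m n n" using step by simp
  have "qreal (d k) \<cdot>\<^sub>m H = H * L k * H"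
    by (rule mat_minus_eq_0D[OF smult_carrier_mat[OF H] mult_carrier_mat[OF 1(2) H] eq])
  moreover have "qreal (d k) \<cdot>\<^sub>m H = 0\<^sub>m n n"
    using H \<open>d k = 0\<close> by (intro eq_matI) (auto simp: qreal_simps)
  ultimately have "H * L k * H = 0\<^sub>m n n" by simp
  \<comment> \<open>A Hermitian matrix with zero square is zero, its square being its own Gram
    matrix; commutation with \<open>H\<close> makes \<open>L k * H\<close> Hermitian.\<close>
  then have "L k * H * (L k * H) = 0\<^sub>m n n"
    by (simp only: assoc_mult_mat[OF L_carrier H 1(4)] assoc_mult_mat[OF H L_carrier H] right_mult_zero_mat[OF L_carrier])
  moreover have "ctrans (L k * H) = L k * H"
    using ctrans_mult[OF L_carrier H] by (simp add: herm L_hermitian L_commute)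
  ultimately have "ctrans (L k * H) * (L k * H) = 0\<^sub>m n n"
    by simp
  then show ?case by (rule gram_eq_0D[OF 1(4)])
qed

lemma L_inner_inverse: "H * (L q * H) = qreal (d q) \<cdot>\<^sub>m H"
proof -
  have 1: "1\<^sub>m n \<in> carrier_mat n n" "H * L q \<in> carrier_mat n n" "qreal x \<cdot>\<^sub>m 1\<^sub>m n \<in> carrier_mat n n" for x
    using H by simp_all
  have "L (Suc q) * H = qreal (d q) \<cdot>\<^sub>m H - H * (L q * H)"
    unfolding L_Suc using H 1
    by (simp add: minus_mult_distrib_mat[OF 1(3,2) H] smult_qreal_mult_left[OF 1(1) H] assoc_mult_mat[of _ n n _ n _ n])
  \<comment> \<open>Since \<open>q \<le> n\<close>, the index \<open>Suc q\<close> lies within the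
    range of the descent.\<close>
  moreover have "L (Suc q) * H = 0\<^sub>m n n"
    using top_minor(2)[of "entries H" n] by (intro L_mult_H_eq_0) simp_all
  ultimately have eq: "qreal (d q) \<cdot>\<^sub>m H - H * (L q * H) = 0\<^sub>m n n" by simp
  show ?thesis
    by (rule mat_minus_eq_0D[OF smult_carrier_mat[OF H] mult_carrier_mat[OF H mult_carrier_mat[OF L_carrier H]] eq, symmetric])
qed

lemma sum_hdet_minor: "(\<Sum>\<beta> \<in> Lkn k n. hdet_minor H \<beta>) = qreal (d k)"
  unfolding minor_sum_def qreal_sum
proof (rule sum.cong[OF refl])
  fix \<beta> assume "\<beta> \<in> Lkn k n"
  then have "\<beta> \<subseteq> {..<n}" by (simp add: Lkn_def)
  then show "hdet_minor H \<beta> = qreal (herm_det (entries H) \<beta>)"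
    using hermitian_on_mono[OF hermitian_entries] by (intro hdet_minor_hermitian[OF H])
qed

lemma sum_cdet_minor:
  assumes c: "\<And>l. l < n \<Longrightarrow> c $ l = c' l"
  shows "(\<Sum>\<beta> \<in> Lkn_with k n g. cdet_minor g (col_repl H g c) \<beta>) = cramer_sum (entries H) c' n k g"
  unfolding cramer_sum_def
proof (rule sum.cong[OF refl])
  fix \<beta> assume "\<beta> \<in> Lkn_with k n g"
  then have b: "\<beta> \<subseteq> {..<n}" "g \<in> \<beta>" by (auto simp: Lkn_with_def Lkn_def)
  have fin: "finite \<beta>" using b(1) finite_subset by blast
  have G: "col_repl H g c \<in> carrier_mat n n" using H by (auto simp: col_repl_def)
  have e: "entries (col_repl H g c) i j = (if j = g then c' i else entries H i j)" if "i \<in> \<beta>" "j \<in> \<beta>" for i j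
  proof -
    have "i < n" "j < n" using that b(1) by auto
    then show ?thesis using H c by (auto simp: col_repl_def)
  qed
  have "hermitian_on (\<beta> - {g}) (entries (col_repl H g c))"
    using b(1) by (intro hermitian_onI) (auto simp: e intro!: hermitian_onD[OF hermitian_entries])
  from cdet_rdet_minor_hermitian(1)[OF G b this]
  show "cdet_minor g (col_repl H g c) \<beta> = cramer (entries H) c' \<beta> g"
    using cdet_on_col_repl[OF fin b(2) e] by simp
qed

text \<open>A row replaced by \<open>c\<close> is the conjugate transpose of a column replaced by
  the conjugates of \<open>c\<close>, so the row case is read off from the column case.\<close>

lemma sum_rdet_minor:
  assumes c: "\<And>l. l < n \<Longrightarrow> qcnj (c $ l) = c' l"
  shows "(\<Sum>\<beta> \<in> Lkn_with k n g. rdet_minor g (row_repl H g c) \<beta>) = qcnj (cramer_sum (entries H) c' n k g)"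
  unfolding cramer_sum_def qcnj_sum
proof (rule sum.cong[OF refl])
  fix \<beta> assume "\<beta> \<in> Lkn_with k n g"
  then have b: "\<beta> \<subseteq> {..<n}" "g \<in> \<beta>" by (auto simp: Lkn_with_def Lkn_def)
  have fin: "finite \<beta>" using b(1) finite_subset by blast
  have G: "row_repl H g c \<in> carrier_mat n n" using H by (auto simp: row_repl_def)
  have e: "entries (row_repl H g c) i j = (if i = g then c $ j else entries H i j)" if "i \<in> \<beta>" "j \<in> \<beta>" for i j
  proof -
    have "i < n" "j < n" using that b(1) by auto
    then show ?thesis using H by (auto simp: row_repl_def)
  qed
  have herm_G: "hermitian_on (\<beta> - {g}) (entries (row_repl H g c))"
    using b(1) by (intro hermitian_onI) (auto simp: e intro!: hermitian_onD[OF hermitian_entries])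
  have "qcnj (cdet_on (entries (row_repl H g c)) \<beta> g) = cdet_on (\<lambda>i j. qcnj (row_repl H g c $$ (j, i))) \<beta> g"
    using fin b(2) herm_G by (intro qcnj_cdet_on) simp_all
  also have "\<dots> = cramer (entries H) c' \<beta> g"
  proof (rule cdet_on_col_repl[OF fin b(2)])
    fix i j assume ij: "i \<in> \<beta>" "j \<in> \<beta>"
    then have "i < n" "j < n" using b(1) by auto
    then have "qcnj (H $$ (j, i)) = H $$ (i, j)"
      using hermitian_onD[OF hermitian_entries, of i j] by simp
    then show "qcnj (row_repl H g c $$ (j, i)) = (if j = g then c' i else entries H i j)"
      using ij \<open>i < n\<close> by (simp add: e c)
  qed
  finally show "rdet_minor g (row_repl H g c) \<beta> = qcnj (cramer (entries H) c' \<beta> g)"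
    unfolding cdet_rdet_minor_hermitian(2)[OF G b herm_G] by (metis qcnj_simps(6))
qed

end

section \<open>The Moore--Penrose inverse and the rank\<close>

definition is_mp :: "quat mat \<Rightarrow> quat mat \<Rightarrow> bool" where
  "is_mp A X \<longleftrightarrow> X \<in> carrier_mat (dim_col A) (dim_row A) \<and>
      A * X * A = A \<and> X * A * X = X \<and> ctrans (A * X) = A * X \<and> ctrans (X * A) = X * A"

text \<open>The classical argument: \<open>A * X\<close> equals \<open>(A * Y) * (A * X)\<close>,
  and taking adjoints reverses this product, which then collapses to \<open>A * Y\<close>. The same
  works for \<open>X * A\<close>, and \<open>X = X * A * X\<close> combines both.\<close>

lemma is_mp_unique:
  assumes "is_mp A X" "is_mp A Y"
  shows "X = Y"
proof -
  obtain m n where A: "A \<in> carrier_mat m n" by blast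
  have X: "X \<in> carrier_mat n m" "A * X * A = A" "X * A * X = X" "ctrans (A * X) = A * X" "ctrans (X * A) = X * A"
    and Y: "Y \<in> carrier_mat n m" "A * Y * A = A" "Y * A * Y = Y" "ctrans (A * Y) = A * Y" "ctrans (Y * A) = Y * A"
    using assms A by (auto simp: is_mp_def)
  note c = mult_carrier_mat[OF A X(1)] mult_carrier_mat[OF A Y(1)] mult_carrier_mat[OF X(1) A] mult_carrier_mat[OF Y(1) A]
  have "A * X = A * Y * A * X" by (simp only: Y)
  also have "\<dots> = (A * Y) * (A * X)" using A X(1) c by (intro assoc_mult_mat) 
  also have "\<dots> = ctrans ((A * X) * (A * Y))" by (simp only: ctrans_mult[OF c(1,2)] X Y)
  also have "(A * X) * (A * Y) = A * X * A * Y" using A Y(1) c by (intro assoc_mult_mat[symmetric])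
  also have "ctrans \<dots> = A * Y" by (simp only: X Y)
  finally have AX: "A * X = A * Y" .
  have "X * A = X * (A * Y * A)" by (simp only: Y)
  also have "A * Y * A = A * (Y * A)" using A Y(1) by (intro assoc_mult_mat)
  also have "X * (A * (Y * A)) = (X * A) * (Y * A)" using A X(1) c by (intro assoc_mult_mat[symmetric])
  also have "\<dots> = ctrans ((Y * A) * (X * A))" by (simp only: ctrans_mult[OF c(4,3)] X Y)
  also have "(Y * A) * (X * A) = Y * (A * (X * A))" using A Y(1) c by (intro assoc_mult_mat)
  also have "A * (X * A) = A * X * A" using A X(1) by (intro assoc_mult_mat[symmetric])
  also have "ctrans (Y * (A * X * A)) = Y * A" by (simp only: X Y)
  finally have XA: "X * A = Y * A" .
  have "X = X * A * X" by (simp only: X)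
  also have "\<dots> = Y * A * X" by (simp only: XA)
  also have "\<dots> = Y * (A * X)" using A X(1) Y(1) by (intro assoc_mult_mat)
  also have "\<dots> = Y * (A * Y)" by (simp only: AX)
  also have "\<dots> = Y * A * Y" using A Y(1) by (intro assoc_mult_mat[symmetric])
  also have "\<dots> = Y" by (simp only: Y)
  finally show ?thesis .
qed

lemma mp_inv_eqI: "is_mp A X \<Longrightarrow> mp_inv A = X"
  unfolding mp_inv_def is_mp_def[symmetric] by (rule the_equality) (auto intro: is_mp_unique)

lemma is_mp_ctrans:
  assumes "is_mp A X"
  shows "is_mp (ctrans A) (ctrans X)"
proof -
  obtain m n where A: "A \<in> carrier_mat m n" by blast
  have X: "X \<in> carrier_mat n m" "A * X * A = A" "X * A * X = X" "ctrans (A * X) = A * X" "ctrans (X * A) = X * A"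
    using assms A by (auto simp: is_mp_def)
  note cA = ctrans_carrier[OF A] and cX = ctrans_carrier[OF X(1)]
  have XA: "ctrans X * ctrans A = A * X" by (simp only: ctrans_mult[OF A X(1), symmetric] X)
  have AX: "ctrans A * ctrans X = X * A" by (simp only: ctrans_mult[OF X(1) A, symmetric] X)
  have "ctrans A * ctrans X * ctrans A = ctrans A * (ctrans X * ctrans A)"
    using cA cX by (intro assoc_mult_mat)
  also have "\<dots> = ctrans A * ctrans (A * X)" by (simp only: XA X)
  also have "\<dots> = ctrans (A * X * A)" by (rule ctrans_mult[OF mult_carrier_mat[OF A X(1)] A, symmetric])
  finally have 1: "ctrans A * ctrans X * ctrans A = ctrans A" by (simp only: X)
  have "ctrans X * ctrans A * ctrans X = ctrans X * (ctrans A * ctrans X)"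
    using cA cX by (intro assoc_mult_mat)
  also have "\<dots> = ctrans X * ctrans (X * A)" by (simp only: AX X)
  also have "\<dots> = ctrans (X * A * X)" by (rule ctrans_mult[OF mult_carrier_mat[OF X(1) A] X(1), symmetric])
  finally have 2: "ctrans X * ctrans A * ctrans X = ctrans X" by (simp only: X)
  show ?thesis
    unfolding is_mp_def using A cX 1 2 by (simp only: XA AX X) auto
qed

lemma qreal_smult_inverse:
  assumes "x \<noteq> 0"
  shows "qreal (inverse x) \<cdot>\<^sub>m (qreal x \<cdot>\<^sub>m M) = M"
proof (rule eq_matI)
  fix i j assume "i < dim_row M" "j < dim_col M"
  then have "(qreal (inverse x) \<cdot>\<^sub>m (qreal x \<cdot>\<^sub>m M)) $$ (i, j) = qreal (inverse x * x) * M $$ (i, j)"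
    by (simp add: qreal_simps mult.assoc)
  then show "(qreal (inverse x) \<cdot>\<^sub>m (qreal x \<cdot>\<^sub>m M)) $$ (i, j) = M $$ (i, j)"
    using assms by (simp add: qreal_simps)
qed auto

lemma hermitian_gram: "A \<in> carrier_mat m n \<Longrightarrow> hermitian_mat (ctrans A * A) n"
  by unfold_locales (auto simp: ctrans_mult[of _ n m _ n] intro!: mult_carrier_mat[of _ n m])

lemma mp_inv_gram:
  assumes A: "A \<in> carrier_mat m n"
  defines "H \<equiv> ctrans A * A"
  defines "q \<equiv> top_minor (entries H) n"
  defines "X \<equiv> qreal (inverse (minor_sum (entries H) n q)) \<cdot>\<^sub>m (herm_adj H q * ctrans A)"
  shows "is_mp A X"
proof -
  interpret hermitian_mat H n unfolding H_def using A by (rule hermitian_gram)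
  define e where "e = inverse (d q)"
  have d: "d q \<noteq> 0" unfolding q_def by (rule top_minor(1))
  have inner: "H * (L q * H) = qreal (d q) \<cdot>\<^sub>m H"
    unfolding q_def by (rule L_inner_inverse)
  let ?A = "ctrans A"
  have cA: "?A \<in> carrier_mat n m" using A by simp
  have LH: "L q * H \<in> carrier_mat n n" and LA: "L q * ?A \<in> carrier_mat n m"
    and dI: "qreal (d q) \<cdot>\<^sub>m 1\<^sub>m n \<in> carrier_mat n n" and AL: "A * L q \<in> carrier_mat m n"
    and ALH: "A * (L q * H) \<in> carrier_mat m n" and dA: "qreal (d q) \<cdot>\<^sub>m A \<in> carrier_mat m n"
    and ALA: "A * (L q * ?A) \<in> carrier_mat m m"
    using mult_carrier_mat[OF L_carrier[of q] H] mult_carrier_mat[OF L_carrier[of q] cA]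
      mult_carrier_mat[OF A L_carrier[of q]] A by (auto intro: mult_carrier_mat)
  have cX: "X \<in> carrier_mat n m" unfolding X_def using LA by simp
  have dist: "M * (L q * H - qreal (d q) \<cdot>\<^sub>m 1\<^sub>m n) = M * (L q * H) - qreal (d q) \<cdot>\<^sub>m M"
    if "M \<in> carrier_mat k n" for M k
    using that by (simp add: mult_minus_distrib_mat[OF that LH dI] smult_qreal_mult_right[OF that one_carrier_mat])
  have ALH_eq: "A * (L q * H) = qreal (d q) \<cdot>\<^sub>m A"
  proof (rule mat_minus_eq_0D[OF ALH dA])
    have "ctrans A * A * (L q * H - qreal (d q) \<cdot>\<^sub>m 1\<^sub>m n) = H * (L q * H) - qreal (d q) \<cdot>\<^sub>m H"
      unfolding H_def[symmetric] by (rule dist[OF H])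
    also have "\<dots> = 0\<^sub>m n n" unfolding inner using H by simp
    \<comment> \<open>The identity for \<open>H * (L q * H)\<close> carries an extra left factor
      \<open>ctrans A\<close>, which the Gram argument cancels.\<close>
    finally have "A * (L q * H - qreal (d q) \<cdot>\<^sub>m 1\<^sub>m n) = 0\<^sub>m m n"
      by (rule gram_cancel_left[OF A minus_carrier_mat[OF dI]])
    then show "A * (L q * H) - qreal (d q) \<cdot>\<^sub>m A = 0\<^sub>m m n"
      unfolding dist[OF A] .
  qed
  have "ctrans (A * (L q * H)) = ctrans (L q * H) * ?A" by (rule ctrans_mult[OF A LH])
  also have "ctrans (L q * H) = L q * H"
    unfolding ctrans_mult[OF L_carrier H] herm L_hermitian by (rule L_commute[symmetric])
  finally have LHA: "L q * H * ?A = qreal (d q) \<cdot>\<^sub>m ?A" by (simp only: ALH_eq ctrans_smult)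
  have XA: "X * A = qreal e \<cdot>\<^sub>m (L q * H)"
    by (simp only: X_def e_def smult_qreal_mult_left[OF LA A] assoc_mult_mat[OF L_carrier cA A] H_def[symmetric])
  have AX: "A * X = qreal e \<cdot>\<^sub>m (A * (L q * ?A))"
    unfolding X_def e_def[symmetric] by (rule smult_qreal_mult_right[OF A LA])
  have inv: "qreal e \<cdot>\<^sub>m (qreal (d q) \<cdot>\<^sub>m M) = M" for M
    unfolding e_def using d by (rule qreal_smult_inverse)
  have "A * X * A = A * (X * A)" using A cX by (intro assoc_mult_mat)
  also have "\<dots> = A" unfolding XA smult_qreal_mult_right[OF A LH] ALH_eq by (rule inv)
  finally have 1: "A * X * A = A" .
  have "X * A * X = qreal e \<cdot>\<^sub>m (qreal e \<cdot>\<^sub>m (L q * H * (L q * ?A)))"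
    unfolding XA unfolding X_def e_def[symmetric] smult_qreal_mult_left[OF LH smult_carrier_mat[OF LA]]
      smult_qreal_mult_right[OF LH LA] ..
  also have "L q * H * (L q * ?A) = L q * (H * (L q * ?A))"
    by (rule assoc_mult_mat[OF L_carrier H LA])
  also have "H * (L q * ?A) = H * L q * ?A"
    by (rule assoc_mult_mat[OF H L_carrier cA, symmetric])
  also have "\<dots> = qreal (d q) \<cdot>\<^sub>m ?A" by (simp only: L_commute[symmetric] LHA)
  also have "L q * (qreal (d q) \<cdot>\<^sub>m ?A) = qreal (d q) \<cdot>\<^sub>m (L q * ?A)"
    by (rule smult_qreal_mult_right[OF L_carrier cA])
  also have "qreal e \<cdot>\<^sub>m (qreal e \<cdot>\<^sub>m (qreal (d q) \<cdot>\<^sub>m (L q * ?A))) = X"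
    unfolding inv unfolding X_def e_def ..
  finally have 2: "X * A * X = X" .
  have "ctrans (A * (L q * ?A)) = A * (L q * ?A)"
    unfolding ctrans_mult[OF A LA] ctrans_mult[OF L_carrier cA] ctrans_ctrans L_hermitian
    using A L_carrier cA by (rule assoc_mult_mat)
  then have 3: "ctrans (A * X) = A * X" unfolding AX ctrans_smult by (simp only:)
  have 4: "ctrans (X * A) = X * A"
    by (simp only: XA ctrans_smult ctrans_mult[OF L_carrier H] herm L_hermitian L_commute[symmetric])
  show ?thesis unfolding is_mp_def using A cX 1 2 3 4 by simp
qed

lemma is_mp_mp_inv: "is_mp A (mp_inv A)"
proof -
  have "A \<in> carrier_mat (dim_row A) (dim_col A)" by simp
  from mp_inv_gram[OF this] show ?thesis using mp_inv_eqI by simp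
qed

lemma mp_inv_ctrans: "mp_inv (ctrans A) = ctrans (mp_inv A)"
  by (intro mp_inv_eqI is_mp_ctrans is_mp_mp_inv)

section \<open>The rank as a real trace\<close>

lemma maximal_independent_columns:
  assumes A: "A \<in> carrier_mat m n"
  obtains S G where "S \<subseteq> {..<n}" "cols_indep A S" "card S = qrank A"
    "\<And>i j. i < m \<Longrightarrow> j < n \<Longrightarrow> A $$ (i, j) = (\<Sum>s\<in>S. A $$ (i, s) * G s j)"
proof -
  let ?K = "{card S | S. S \<subseteq> {..<dim_col A} \<and> cols_indep A S}"
  have "?K \<subseteq> card ` Pow {..<dim_col A}" by auto
  then have fin: "finite ?K" by (rule finite_subset) simp
  have "cols_indep A {}" by (simp add: cols_indep_def)
  then have "card ({} :: nat set) \<in> ?K" by blast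
  then have "Max ?K \<in> ?K" using fin by (intro Max_in) auto
  then obtain S where S: "S \<subseteq> {..<n}" "cols_indep A S" "card S = qrank A"
    using A by (auto simp: qrank_def)
  have finS: "finite S" using S(1) finite_subset by blast
  have "\<exists>c. \<forall>i<m. A $$ (i, j) = (\<Sum>s\<in>S. A $$ (i, s) * c s)" if j: "j < n" for j
  proof (cases "j \<in> S")
    case True
    have "A $$ (i, j) = (\<Sum>s\<in>S. A $$ (i, s) * (if s = j then 1 else 0))" for i
    proof -
      have "(\<Sum>s\<in>S. A $$ (i, s) * (if s = j then 1 else 0)) = (\<Sum>s\<in>S. if s = j then A $$ (i, s) else 0)"
        by (rule sum.cong) auto
      then show ?thesis using True finS by simp
    qed
    then show ?thesis by (intro exI[of _ "\<lambda>s. if s = j then 1 else 0"]) blast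
  next
    case False
    \<comment> \<open>By maximality of \<open>S\<close> the enlarged set is dependent; the
      coefficient at \<open>j\<close> cannot vanish, so column \<open>j\<close> is solved for by
      division on the right.\<close>
    have "\<not> cols_indep A (insert j S)"
    proof
      assume "cols_indep A (insert j S)"
      then have "card (insert j S) \<in> ?K" using S(1) j A by blast
      then have "card (insert j S) \<le> qrank A" unfolding qrank_def by (rule Max_ge[OF fin])
      then show False using False finS S(3) by simp
    qed
    then obtain c l where c: "\<And>i. i < m \<Longrightarrow> (\<Sum>s\<in>insert j S. A $$ (i, s) * c s) = 0"
      and l: "l \<in> insert j S" "c l \<noteq> 0"
      using A unfolding cols_indep_def by auto
    have c': "A $$ (i, j) * c j + (\<Sum>s\<in>S. A $$ (i, s) * c s) = 0" if "i < m" for i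
      using c[OF that] finS False by simp
    have cj: "c j \<noteq> 0"
    proof
      assume "c j = 0"
      then have "\<forall>i<dim_row A. (\<Sum>s\<in>S. A $$ (i, s) * c s) = 0" using c' A by simp
      then have "\<forall>s\<in>S. c s = 0" using S(2) unfolding cols_indep_def by blast
      then show False using l \<open>c j = 0\<close> by auto
    qed
    have "A $$ (i, j) = (\<Sum>s\<in>S. A $$ (i, s) * (- c s * inverse (c j)))" if "i < m" for i
    proof -
      have "A $$ (i, j) = A $$ (i, j) * c j * inverse (c j)" using cj by (simp add: mult.assoc)
      also have "A $$ (i, j) * c j = - (\<Sum>s\<in>S. A $$ (i, s) * c s)"
        using c'[OF that] by (simp add: eq_neg_iff_add_eq_0)
      finally show ?thesis by (simp add: sum_distrib_right mult.assoc sum_negf)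
    qed
    then show ?thesis by (intro exI[of _ "\<lambda>s. - c s * inverse (c j)"]) blast
  qed
  then obtain G where "\<And>j i. j < n \<Longrightarrow> i < m \<Longrightarrow> A $$ (i, j) = (\<Sum>s\<in>S. A $$ (i, s) * G j s)"
    by metis
  then show thesis using that[OF S, of "\<lambda>s j. G j s"] by blast
qed

text \<open>The trace of an idempotent is its rank: factor \<open>A\<close> through a maximal independent set of
  columns and use that real parts of traces are cyclic.\<close>
lemma trace_eq_qrank:
  assumes A: "A \<in> carrier_mat m n" and X: "X \<in> carrier_mat n m" and AXA: "A * X * A = A"
  shows "(\<Sum>j<n. qre ((X * A) $$ (j, j))) = real (qrank A)"
proof -
  obtain S G where S: "S \<subseteq> {..<n}" "cols_indep A S" "card S = qrank A"
    and G: "\<And>i j. i < m \<Longrightarrow> j < n \<Longrightarrow> A $$ (i, j) = (\<Sum>s\<in>S. A $$ (i, s) * G s j)"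
    by (rule maximal_independent_columns[OF A], rule that)
  have finS: "finite S" using S(1) finite_subset by blast
  define P where "P j s = (X * A) $$ (j, s)" for j s
  have P: "P j s = (\<Sum>i<m. X $$ (j, i) * A $$ (i, s))" if "j < n" "s < n" for j s
    unfolding P_def by (rule index_mult_mat_sum[OF X A that])
  \<comment> \<open>With \<open>A\<close> factored as its columns in \<open>S\<close> times
    \<open>G\<close>, the identity \<open>A * X * A = A\<close> and the independence of these
    columns force \<open>G * X * A\<close>, restricted to columns in \<open>S\<close>, to be the
    identity.\<close>
  have diag: "(\<Sum>j<n. G s j * P j s) = 1" if s: "s \<in> S" for s
  proof -
    define M where "M t = (\<Sum>j<n. G t j * P j s)" for t
    have s': "s < n" using s S(1) by auto
    have "(\<Sum>t\<in>S. A $$ (i, t) * (M t - (if t = s then 1 else 0))) = 0" if i: "i < m" for i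
    proof -
      have "(\<Sum>t\<in>S. A $$ (i, t) * M t) = (\<Sum>t\<in>S. \<Sum>j<n. A $$ (i, t) * G t j * P j s)"
        by (simp add: M_def sum_distrib_left mult.assoc)
      also have "\<dots> = (\<Sum>j<n. \<Sum>t\<in>S. A $$ (i, t) * G t j * P j s)" by (rule sum.swap)
      also have "\<dots> = (\<Sum>j<n. A $$ (i, j) * P j s)"
        by (rule sum.cong[OF refl]) (simp only: lessThan_iff G[OF i] sum_distrib_right)
      also have "\<dots> = (A * (X * A)) $$ (i, s)"
        unfolding P_def using i s' by (intro index_mult_mat_sum[symmetric, OF A mult_carrier_mat[OF X A]])
      also have "A * (X * A) = A"
        using AXA assoc_mult_mat[OF A X A] by simp
      finally have "(\<Sum>t\<in>S. A $$ (i, t) * M t) = A $$ (i, s)" .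
      moreover have "(\<Sum>t\<in>S. A $$ (i, t) * (if t = s then 1 else 0)) = (\<Sum>t\<in>S. if t = s then A $$ (i, t) else 0)"
        by (rule sum.cong) auto
      ultimately show ?thesis
        using s finS by (simp add: right_diff_distrib sum_subtractf)
    qed
    then have "\<forall>i<dim_row A. (\<Sum>t\<in>S. A $$ (i, t) * (M t - (if t = s then 1 else 0))) = 0"
      using A by simp
    then have "\<forall>t\<in>S. M t - (if t = s then 1 else 0) = 0"
      by (rule mp[OF spec[OF S(2)[unfolded cols_indep_def]]])
    then have "M s - (if s = s then 1 else 0) = 0" using s by blast
    then show ?thesis by (simp add: M_def)
  qed
  \<comment> \<open>The same factorization applied to the right factor of \<open>X * A\<close>;
    swapping factors under \<open>qre\<close> then leads back to the sums in
    \<open>diag\<close>.\<close>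
  have "P j j = (\<Sum>s\<in>S. P j s * G s j)" if j: "j < n" for j
  proof -
    have "P j j = (\<Sum>i<m. \<Sum>s\<in>S. X $$ (j, i) * A $$ (i, s) * G s j)"
      unfolding P[OF j j] by (rule sum.cong[OF refl]) (simp only: lessThan_iff G[OF _ j] sum_distrib_left mult.assoc)
    also have "\<dots> = (\<Sum>s\<in>S. \<Sum>i<m. X $$ (j, i) * A $$ (i, s) * G s j)" by (rule sum.swap)
    also have "\<dots> = (\<Sum>s\<in>S. P j s * G s j)"
    proof (rule sum.cong[OF refl])
      fix s assume "s \<in> S"
      then have "s < n" using S(1) by auto
      then show "(\<Sum>i<m. X $$ (j, i) * A $$ (i, s) * G s j) = P j s * G s j"
        by (simp only: P[OF j] sum_distrib_right)
    qed
    finally show ?thesis .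
  qed
  then have "(\<Sum>j<n. qre (P j j)) = (\<Sum>j<n. \<Sum>s\<in>S. qre (G s j * P j s))"
    by (simp add: qre_mult_commute)
  also have "\<dots> = (\<Sum>s\<in>S. qre (\<Sum>j<n. G s j * P j s))"
    unfolding qre_sum by (rule sum.swap)
  also have "\<dots> = real (card S)" by (simp add: diag del: qre_sum)
  finally show ?thesis by (simp add: P_def S(3))
qed

text \<open>As \<open>qrank\<close> looks only at columns, this is the equality of row and column
  rank: the two ranks are the real traces of \<open>A * X\<close> and \<open>X * A\<close>, which
  agree by cyclicity.\<close>

lemma qrank_ctrans: "qrank (ctrans A) = qrank A"
proof -
  obtain m n where A: "A \<in> carrier_mat m n" by blast
  define X where "X = mp_inv A"
  have X: "X \<in> carrier_mat n m" "A * X * A = A" "ctrans (A * X) = A * X"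
    using is_mp_mp_inv[of A] A by (auto simp: is_mp_def X_def)
  have mp: "is_mp (ctrans A) (ctrans X)" unfolding X_def by (intro is_mp_ctrans is_mp_mp_inv)
  have "real (qrank (ctrans A)) = (\<Sum>i<m. qre ((ctrans X * ctrans A) $$ (i, i)))"
    using mp A X(1) by (intro trace_eq_qrank[symmetric, of _ n]) (auto simp: is_mp_def)
  also have "ctrans X * ctrans A = A * X" by (simp only: ctrans_mult[OF A X(1), symmetric] X(3))
  also have "(\<Sum>i<m. qre ((A * X) $$ (i, i))) = (\<Sum>i<m. \<Sum>j<n. qre (A $$ (i, j) * X $$ (j, i)))"
    by (rule sum.cong[OF refl]) (simp only: lessThan_iff index_mult_mat_sum[OF A X(1)] qre_sum)
  also have "\<dots> = (\<Sum>i<m. \<Sum>j<n. qre (X $$ (j, i) * A $$ (i, j)))"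
    by (simp only: qre_mult_commute)
  also have "\<dots> = (\<Sum>j<n. \<Sum>i<m. qre (X $$ (j, i) * A $$ (i, j)))" by (rule sum.swap)
  also have "\<dots> = (\<Sum>j<n. qre ((X * A) $$ (j, j)))"
    by (rule sum.cong[OF refl]) (simp only: lessThan_iff index_mult_mat_sum[OF X(1) A] qre_sum)
  also have "\<dots> = real (qrank A)" by (rule trace_eq_qrank[OF A X(1,2)])
  finally show ?thesis by simp
qed

lemma top_minor_eq_qrank:
  assumes A: "A \<in> carrier_mat m n"
  shows "top_minor (entries (ctrans A * A)) n = qrank A"
proof -
  define H where "H = ctrans A * A"
  interpret hermitian_mat H n unfolding H_def using A by (rule hermitian_gram)
  define X where "X = qreal (inverse (d q)) \<cdot>\<^sub>m (L q * ctrans A)"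
  have mp: "is_mp A X" unfolding X_def H_def by (rule mp_inv_gram[OF A])
  have X: "X \<in> carrier_mat n m" "A * X * A = A" using mp A by (auto simp: is_mp_def)
  have cA: "ctrans A \<in> carrier_mat n m" using A by simp
  have "X * A = qreal (inverse (d q)) \<cdot>\<^sub>m (L q * H)"
    by (simp only: X_def smult_qreal_mult_left[OF mult_carrier_mat[OF L_carrier cA] A]
      assoc_mult_mat[OF L_carrier cA A] H_def[symmetric])
  then have "(X * A) $$ (j, j) = qreal (inverse (d q)) * (L q * H) $$ (j, j)" if "j < n" for j
    using that H by (simp del: index_mult_mat(1))
  then have "(\<Sum>j<n. qre ((X * A) $$ (j, j))) = inverse (d q) * qre (\<Sum>j<n. (L q * H) $$ (j, j))"
    by (simp add: sum_distrib_left del: index_mult_mat(1))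
  \<comment> \<open>Each principal minor of order \<open>q\<close> enters the trace of
    \<open>L q * H\<close> exactly \<open>q\<close> times.\<close>
  also have "(\<Sum>j<n. (L q * H) $$ (j, j)) = qreal (real q * d q)"
    using cramer_sum_trace[OF hermitian_entries, of q] by (simp add: L_mult_index[OF H] del: index_mult_mat(1))
  also have "inverse (d q) * qre (qreal (real q * d q)) = real q"
    using top_minor(1)[of "entries H" n] by simp
  finally show ?thesis using trace_eq_qrank[OF A X] by (simp add: H_def)
qed

section \<open>Entries of products with the Moore--Penrose inverse\<close>

lemma mp_inv_mult_index:
  assumes A: "A \<in> carrier_mat m n" and Y: "Y \<in> carrier_mat m k" and ij: "i < n" "j < k"
  shows "(mp_inv A * Y) $$ (i, j)
    = cramer_sum (entries (ctrans A * A)) (\<lambda>l. (ctrans A * Y) $$ (l, j)) n (qrank A) i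
      / qreal (minor_sum (entries (ctrans A * A)) n (qrank A))"
proof -
  define H where "H = ctrans A * A"
  interpret hermitian_mat H n unfolding H_def using A by (rule hermitian_gram)
  have q: "q = qrank A" unfolding H_def by (rule top_minor_eq_qrank[OF A])
  have cA: "ctrans A \<in> carrier_mat n m" using A by simp
  have AY: "ctrans A * Y \<in> carrier_mat n k" using cA Y by simp
  have "mp_inv A = qreal (inverse (d q)) \<cdot>\<^sub>m (L q * ctrans A)"
    unfolding H_def by (rule mp_inv_eqI[OF mp_inv_gram[OF A]])
  then have "mp_inv A * Y = qreal (inverse (d q)) \<cdot>\<^sub>m (L q * (ctrans A * Y))"
    by (simp only: smult_qreal_mult_left[OF mult_carrier_mat[OF L_carrier cA] Y] assoc_mult_mat[OF L_carrier cA Y])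
  then have "(mp_inv A * Y) $$ (i, j) = qreal (inverse (d q)) * (L q * (ctrans A * Y)) $$ (i, j)"
    using ij cA Y by (simp del: index_mult_mat(1))
  also have "\<dots> = cramer_sum (entries H) (\<lambda>l. (ctrans A * Y) $$ (l, j)) n q i / qreal (d q)"
    by (simp only: L_mult_index[OF AY ij] divide_inverse inverse_qreal qreal_commute)
  finally show ?thesis unfolding q unfolding H_def .
qed

lemma qcnj_divide_qreal: "qcnj (a / qreal x) = qcnj a / qreal x"
  by (simp add: divide_inverse inverse_qreal qreal_commute)

text \<open>The order of the numerators is kept; the denominators may be collected on the right
  because they are real.\<close>

lemma divide_qreal_mult: "(a / qreal x) * (b / qreal y) = a * b / (qreal x * qreal y)"
proof -
  have "(a / qreal x) * (b / qreal y) = a * (qreal (inverse x) * (b * qreal (inverse y)))"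
    by (simp only: divide_inverse inverse_qreal mult.assoc)
  also have "\<dots> = a * b * (qreal (inverse x) * qreal (inverse y))"
    by (simp only: qreal_left_commute[of b, symmetric] mult.assoc)
  also have "qreal (inverse x) * qreal (inverse y) = inverse (qreal x * qreal y)"
    unfolding qreal_simps(6)[symmetric] inverse_qreal by (simp add: inverse_mult_distrib)
  finally show ?thesis by (simp only: divide_inverse)
qed

text \<open>The factor \<open>Y\<close> is general so that one formula covers both \<open>C\<close>
  and, with \<open>Y = A\<close>, the projection \<open>proj_P A\<close>.\<close>

lemma mp_inv_mult_index_cdet:
  assumes A: "A \<in> carrier_mat m n" and Y: "Y \<in> carrier_mat m k" and gf: "g < n" "f < k"
  shows "(mp_inv A * Y) $$ (g, f) =
    (\<Sum>\<beta> \<in> Lkn_with (qrank A) n g. cdet_minor g (col_repl (ctrans A * A) g (col (ctrans A * Y) f)) \<beta>)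
    / (\<Sum>\<beta> \<in> Lkn (qrank A) n. hdet_minor (ctrans A * A) \<beta>)"
proof -
  interpret hermitian_mat "ctrans A * A" n using A by (rule hermitian_gram)
  have "col (ctrans A * Y) f $ l = (ctrans A * Y) $$ (l, f)" if "l < n" for l
    using A Y gf that by (intro index_col) simp_all
  then show ?thesis
    unfolding mp_inv_mult_index[OF A Y gf] sum_hdet_minor by (subst sum_cdet_minor) simp_all
qed

text \<open>\<open>C * mp_inv B\<close> is the conjugate transpose of
  \<open>mp_inv (ctrans B) * ctrans C\<close>, and the Gram matrix of \<open>ctrans B\<close> is
  \<open>B * ctrans B\<close>; equality of ranks under conjugate transposition keeps the order of
  the minors.\<close>

lemma mult_mp_inv_index_rdet:
  assumes B: "B \<in> carrier_mat r s" and C: "C \<in> carrier_mat m s" and ij: "i < m" "j < r"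
  shows "(C * mp_inv B) $$ (i, j) =
    (\<Sum>\<alpha> \<in> Lkn_with (qrank B) r j. rdet_minor j (row_repl (B * ctrans B) j (row (C * ctrans B) i)) \<alpha>)
    / (\<Sum>\<alpha> \<in> Lkn (qrank B) r. hdet_minor (B * ctrans B) \<alpha>)"
proof -
  have cB: "ctrans B \<in> carrier_mat s r" and cC: "ctrans C \<in> carrier_mat s m" using B C by simp_all
  interpret hermitian_mat "B * ctrans B" r using hermitian_gram[OF cB] by simp
  have X: "mp_inv B \<in> carrier_mat s r" using is_mp_mp_inv[of B] B by (auto simp: is_mp_def)
  have CX: "C * mp_inv B \<in> carrier_mat m r" and CB: "C * ctrans B \<in> carrier_mat m r"
    using C X cB by (auto intro: mult_carrier_mat)
  have c': "qcnj (row (C * ctrans B) i $ l) = (B * ctrans C) $$ (l, i)" if l: "l < r" for l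
  proof -
    have "B * ctrans C = ctrans (C * ctrans B)" by (simp add: ctrans_mult[OF C cB])
    then show ?thesis using carrier_matD[OF CB] l ij by (simp del: index_mult_mat)
  qed
  have "(C * mp_inv B) $$ (i, j) = qcnj (ctrans (C * mp_inv B) $$ (j, i))"
    using carrier_matD[OF CX] ij by (subst ctrans_index) (simp_all del: index_mult_mat)
  also have "ctrans (C * mp_inv B) = mp_inv (ctrans B) * ctrans C"
    unfolding mp_inv_ctrans by (rule ctrans_mult[OF C X])
  also have "\<dots> $$ (j, i) = cramer_sum (entries (B * ctrans B)) (\<lambda>l. (B * ctrans C) $$ (l, i)) r (qrank B) j
      / qreal (minor_sum (entries (B * ctrans B)) r (qrank B))"
    using mp_inv_mult_index[OF cB cC ij(2,1)] by (simp only: ctrans_ctrans qrank_ctrans)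
  finally show ?thesis
    unfolding sum_hdet_minor qcnj_divide_qreal by (subst sum_rdet_minor[OF c']) simp_all
qed

theorem theorem5p4:
  fixes B1 A2 C :: "quat mat" and r s m p r1 r2 :: nat
  assumes B1: "B1 \<in> carrier_mat r s" and rkB1: "qrank B1 = r1"
    and A2: "A2 \<in> carrier_mat m p" and rkA2: "qrank A2 = r2"
    and C: "C \<in> carrier_mat m s"
  shows "(\<forall>i < m. \<forall>j < r.
      (C * mp_inv B1) $$ (i, j) =
        (\<Sum>\<alpha> \<in> Lkn_with r1 r j.
            rdet_minor j (row_repl (B1 * ctrans B1) j (row (C * ctrans B1) i)) \<alpha>)
        / (\<Sum>\<alpha> \<in> Lkn r1 r. hdet_minor (B1 * ctrans B1) \<alpha>))
   \<and> (\<forall>g < p. \<forall>f < s.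
      (mp_inv A2 * C - mp_inv A2 * C * proj_P B1) $$ (g, f) =
        (\<Sum>\<beta> \<in> Lkn_with r2 p g.
            cdet_minor g (col_repl (ctrans A2 * A2) g (col (ctrans A2 * C) f)) \<beta>)
        / (\<Sum>\<beta> \<in> Lkn r2 p. hdet_minor (ctrans A2 * A2) \<beta>)
      - (\<Sum>l < s.
           (\<Sum>\<beta> \<in> Lkn_with r2 p g.
               cdet_minor g (col_repl (ctrans A2 * A2) g (col (ctrans A2 * C) l)) \<beta>)
         * (\<Sum>\<beta> \<in> Lkn_with r1 s l.
               cdet_minor l (col_repl (ctrans B1 * B1) l (col (ctrans B1 * B1) f)) \<beta>))
        / ((\<Sum>\<beta> \<in> Lkn r2 p. hdet_minor (ctrans A2 * A2) \<beta>)
           * (\<Sum>\<beta> \<in> Lkn r1 s. hdet_minor (ctrans B1 * B1) \<beta>)))"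
proof (intro conjI allI impI)
  fix i j assume "i < m" "j < r"
  then show "(C * mp_inv B1) $$ (i, j) =
        (\<Sum>\<alpha> \<in> Lkn_with r1 r j.
            rdet_minor j (row_repl (B1 * ctrans B1) j (row (C * ctrans B1) i)) \<alpha>)
        / (\<Sum>\<alpha> \<in> Lkn r1 r. hdet_minor (B1 * ctrans B1) \<alpha>)"
    unfolding rkB1[symmetric] by (rule mult_mp_inv_index_rdet[OF B1 C])
next
  fix g f assume gf: "g < p" "f < s"
  define N where "N l = (\<Sum>\<beta> \<in> Lkn_with r2 p g.
    cdet_minor g (col_repl (ctrans A2 * A2) g (col (ctrans A2 * C) l)) \<beta>)" for l
  define M where "M l = (\<Sum>\<beta> \<in> Lkn_with r1 s l.
    cdet_minor l (col_repl (ctrans B1 * B1) l (col (ctrans B1 * B1) f)) \<beta>)" for l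
  define a where "a = minor_sum (entries (ctrans A2 * A2)) p r2"
  define b where "b = minor_sum (entries (ctrans B1 * B1)) s r1"
  have a: "(\<Sum>\<beta> \<in> Lkn r2 p. hdet_minor (ctrans A2 * A2) \<beta>) = qreal a"
    unfolding a_def by (rule hermitian_mat.sum_hdet_minor[OF hermitian_gram[OF A2]])
  have b: "(\<Sum>\<beta> \<in> Lkn r1 s. hdet_minor (ctrans B1 * B1) \<beta>) = qreal b"
    unfolding b_def by (rule hermitian_mat.sum_hdet_minor[OF hermitian_gram[OF B1]])
  have cA: "mp_inv A2 * C \<in> carrier_mat p s" and cP: "proj_P B1 \<in> carrier_mat s s"
    using is_mp_mp_inv[of A2] is_mp_mp_inv[of B1] A2 B1 C
    by (auto simp: is_mp_def proj_P_def intro: mult_carrier_mat)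
  have AC: "(mp_inv A2 * C) $$ (g, l) = N l / qreal a" if "l < s" for l
    using mp_inv_mult_index_cdet[OF A2 C gf(1) that] by (simp only: rkA2 N_def a)
  \<comment> \<open>For \<open>Y = B1\<close> the column put into the Gram matrix is a column of the
    Gram matrix itself.\<close>
  have P: "proj_P B1 $$ (l, f) = M l / qreal b" if "l < s" for l
    using mp_inv_mult_index_cdet[OF B1 B1 that gf(2)] by (simp only: proj_P_def rkB1 M_def b)
  have "(mp_inv A2 * C * proj_P B1) $$ (g, f) = (\<Sum>l<s. (N l / qreal a) * (M l / qreal b))"
    unfolding index_mult_mat_sum[OF cA cP gf] by (rule sum.cong[OF refl]) (simp only: lessThan_iff AC P)
  also have "\<dots> = (\<Sum>l<s. N l * M l) / (qreal a * qreal b)"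
    unfolding divide_qreal_mult by (simp only: divide_inverse sum_distrib_right)
  finally have "(mp_inv A2 * C - mp_inv A2 * C * proj_P B1) $$ (g, f)
      = N f / qreal a - (\<Sum>l<s. N l * M l) / (qreal a * qreal b)"
    using carrier_matD[OF mult_carrier_mat[OF cA cP]] gf
    by (subst index_minus_mat) (simp_all only: AC[OF gf(2)])
  then show "(mp_inv A2 * C - mp_inv A2 * C * proj_P B1) $$ (g, f) =
        (\<Sum>\<beta> \<in> Lkn_with r2 p g.
            cdet_minor g (col_repl (ctrans A2 * A2) g (col (ctrans A2 * C) f)) \<beta>)
        / (\<Sum>\<beta> \<in> Lkn r2 p. hdet_minor (ctrans A2 * A2) \<beta>)
      - (\<Sum>l < s.
           (\<Sum>\<beta> \<in> Lkn_with r2 p g.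
               cdet_minor g (col_repl (ctrans A2 * A2) g (col (ctrans A2 * C) l)) \<beta>)
         * (\<Sum>\<beta> \<in> Lkn_with r1 s l.
               cdet_minor l (col_repl (ctrans B1 * B1) l (col (ctrans B1 * B1) f)) \<beta>))
        / ((\<Sum>\<beta> \<in> Lkn r2 p. hdet_minor (ctrans A2 * A2) \<beta>)
           * (\<Sum>\<beta> \<in> Lkn r1 s. hdet_minor (ctrans B1 * B1) \<beta>))"
    unfolding a b N_def[symmetric] M_def[symmetric] .
qed

end
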